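(* For all positive integers $d$, $k<d$ and $p\ge k+2$ there exists a constant $C$ such that the following holds. If $\mathcal{F}_1,\ldots,\mathcal{F}_p$ are finite families of closed caps in $\mathbb{S}^d$ such that for every choice $B_1\in\mathcal{F}_1,\ldots,B_p\in\mathcal{F}_p$ there are $k+2$ among $B_1,\ldots,B_p$ that can be hit by a single great $k$-sphere, then there exist an index $i\in\{1,\ldots,p\}$ and at most $C$ great $k$-spheres such that every cap of $\mathcal{F}_i$ is intersected by one of them.
   Context: $\mathbb{S}^d$ is the unit sphere in $\mathbb{R}^{d+1}$ centered at the origin. A closed cap is a set $B(x,\varepsilon)=\{y\in\mathbb{S}^d:\angle(x,y)\le\varepsilon\}$ with $x\in\mathbb{S}^d$, $\varepsilon\ge0$. A great $k$-sphere is the intersection of $\mathbb{S}^d$ with a $(k+1)$-dimensional linear subspace of $\mathbb{R}^{d+1}$; it hits a set if they intersect. *)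

theory Defs
  imports "HOL-Analysis.Analysis"
begin

text \<open>
  The sphere of dimension \<open>d\<close> is \<open>sphere 0 1\<close> in \<open>real ^ 'n\<close> with \<open>CARD('n) = d + 1\<close>.
\<close>

text \<open>For unit vectors this is the angle, i.e. the geodesic distance on the sphere.\<close>
definition sphere_angle :: "real ^ 'n \<Rightarrow> real ^ 'n \<Rightarrow> real" where
  "sphere_angle x y = arccos (x \<bullet> y)"

definition cap :: "real ^ 'n \<Rightarrow> real \<Rightarrow> (real ^ 'n) set" where
  "cap x \<epsilon> = {y \<in> sphere 0 1. sphere_angle x y \<le> \<epsilon>}"

definition closed_caps :: "(real ^ 'n) set set" where
  "closed_caps = {cap x \<epsilon> | x \<epsilon>. x \<in> sphere 0 1 \<and> 0 \<le> \<epsilon>}"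

definition great_spheres :: "nat \<Rightarrow> (real ^ 'n) set set" where
  "great_spheres k = {sphere 0 1 \<inter> V | V. subspace V \<and> dim V = k + 1}"

definition hits :: "'a set \<Rightarrow> 'a set \<Rightarrow> bool" where
  "hits S B \<longleftrightarrow> S \<inter> B \<noteq> {}"

end

theory Submission
  imports Defs
begin

text \<open>
  A cap with centre \<open>x\<close> and radius \<open>\<epsilon> \<le> pi / 2\<close> is hit by the great sphere of a linear subspace
  \<open>V\<close> iff \<open>V\<close> meets the ball of radius \<open>sin \<epsilon>\<close> around \<open>x\<close>, so the claim is about balls and
  linear subspaces of dimension \<open>m = k + 1\<close>.

  If \<open>m + 1\<close> balls are met by one such subspace, then points of the balls on it satisfy a linear relation
  \<open>\<Sum> c_i b_i = 0\<close>. For the index \<open>j\<close> maximizing \<open>|c_j| r_j\<close>, the other \<open>m\<close> points can be moved to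
  points of a fixed grid (scaled to each ball) while \<open>b_j\<close> stays in its ball. Hence one of boundedly many
  subspaces determined by \<open>m\<close> of the balls meets the remaining one. Choosing a rainbow tuple at random
  with respect to arbitrary weights on the families, some subspace meets a fixed proportion \<open>\<beta>\<close> of the weight of
  some family. Halving the weights of the balls that were met and iterating
  yields a family \<open>F i\<close> and a finite sequence of subspaces such that each ball of \<open>F i\<close> meets at least
  the fraction \<open>\<beta> / 4\<close> of the sequence. The resulting set system has bounded VC dimension, so by the
  epsilon net theorem boundedly many members of the sequence meet all balls of \<open>F i\<close>.
\<close>

section \<open>Traces of set systems of bounded VC dimension\<close>

definition shatters :: "'a set set \<Rightarrow> 'a set \<Rightarrow> bool" where
  "shatters \<R> A \<longleftrightarrow> (\<forall>S\<subseteq>A. \<exists>R\<in>\<R>. R \<inter> A = S)"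

text \<open>Pajor's form of the Sauer-Shelah lemma. In the induction the sets are split by whether
  they contain \<open>x\<close>, and \<open>x\<close> is then deleted. A set \<open>A\<close>
  shattered by both halves is counted twice, once as \<open>A\<close> and once as
  \<open>insert x A\<close>.\<close>

lemma card_le_card_shattered:
  assumes "finite X" "\<R> \<subseteq> Pow X"
  shows "card \<R> \<le> card {A \<in> Pow X. shatters \<R> A}"
  using assms
proof (induction X arbitrary: \<R> rule: finite_induct)
  case empty
  then consider "\<R> = {}" | "\<R> = {{}}" by fastforce
  then show ?case
  proof cases
    case 2
    then have "{A \<in> Pow {}. shatters \<R> A} = {{}}" by (auto simp: shatters_def)
    with 2 show ?thesis by simp
  qed simp
next
  case (insert x X)
  define R0 where "R0 = {R \<in> \<R>. x \<notin> R}"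
  define R1 where "R1 = {R \<in> \<R>. x \<in> R}"
  define R1' where "R1' = (\<lambda>R. R - {x}) ` R1"
  let ?sh = "\<lambda>Q. {A \<in> Pow X. shatters Q A}"
  have fin: "finite \<R>" using insert.prems insert.hyps(1)
    by (meson finite.insertI finite_Pow_iff finite_subset)
  have "\<R> = R0 \<union> R1" "R0 \<inter> R1 = {}" by (auto simp: R0_def R1_def)
  then have "card \<R> = card R0 + card R1" using fin by (simp add: card_Un_disjoint)
  also have "card R1 = card R1'"
    unfolding R1'_def by (rule card_image[symmetric]) (auto simp: inj_on_def R1_def)
  also have "card R0 + card R1' \<le> card (?sh R0) + card (?sh R1')"
    by (intro add_mono insert.IH) (use insert.prems in \<open>auto simp: R0_def R1_def R1'_def\<close>)
  also have "\<dots> = card (?sh R0 \<union> ?sh R1') + card (?sh R0 \<inter> ?sh R1')"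
    by (rule card_Un_Int) (use insert.hyps in auto)
  also have "card (?sh R0 \<inter> ?sh R1') = card (insert x ` (?sh R0 \<inter> ?sh R1'))"
    by (rule card_image[symmetric]) (use insert.hyps in \<open>auto simp: inj_on_def\<close>)
  also have "card (?sh R0 \<union> ?sh R1') + \<dots>
      = card ((?sh R0 \<union> ?sh R1') \<union> insert x ` (?sh R0 \<inter> ?sh R1'))"
    by (rule card_Un_disjoint[symmetric]) (use insert.hyps in auto)
  also have "\<dots> \<le> card {A \<in> Pow (insert x X). shatters \<R> A}"
  proof (rule card_mono)
    have "shatters \<R> A" if "shatters R0 A" for A
      using that by (auto simp: shatters_def R0_def)
    moreover have "shatters \<R> A" if A: "A \<subseteq> X" "shatters R1' A" for A
      unfolding shatters_def
    proof (intro allI impI)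
      fix S assume "S \<subseteq> A"
      then obtain R where "R \<in> R1" "(R - {x}) \<inter> A = S"
        using A unfolding shatters_def R1'_def by blast
      moreover from this have "R \<inter> A = S" using A insert.hyps by auto
      ultimately show "\<exists>R\<in>\<R>. R \<inter> A = S" by (auto simp: R1_def)
    qed
    moreover have "shatters \<R> (insert x A)"
      if A: "A \<subseteq> X" "shatters R0 A" "shatters R1' A" for A
      unfolding shatters_def
    proof (intro allI impI)
      fix S assume S: "S \<subseteq> insert x A"
      show "\<exists>R\<in>\<R>. R \<inter> insert x A = S"
      proof (cases "x \<in> S")
        case True
        have "S - {x} \<subseteq> A" using S by auto
        then obtain R where "R \<in> R1" "(R - {x}) \<inter> A = S - {x}"
          using A(3) unfolding shatters_def R1'_def by blast
        then have "R \<in> \<R>" "R \<inter> insert x A = S" using True S by (auto simp: R1_def)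
        then show ?thesis by blast
      next
        case False
        then have "S \<subseteq> A" using S by auto
        then obtain R where "R \<in> R0" "R \<inter> A = S"
          using A(2) unfolding shatters_def by blast
        then have "R \<in> \<R>" "R \<inter> insert x A = S" by (auto simp: R0_def)
        then show ?thesis by blast
      qed
    qed
    ultimately show "?sh R0 \<union> ?sh R1' \<union> insert x ` (?sh R0 \<inter> ?sh R1')
        \<subseteq> {A \<in> Pow (insert x X). shatters \<R> A}"
      by auto
  qed (use insert.hyps in auto)
  finally show ?case .
qed

lemma card_bounded_subsets_le:
  assumes "finite W"
  shows "card {A. A \<subseteq> W \<and> card A \<le> D} \<le> (card W + 1) ^ D"
proof (induction D)
  case 0
  have "{A. A \<subseteq> W \<and> card A \<le> 0} = {{}}"
    using assms by (auto dest: finite_subset)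
  then show ?case by simp
next
  case (Suc D)
  let ?P = "\<lambda>D. {A. A \<subseteq> W \<and> card A \<le> D}"
  have "?P (Suc D) \<subseteq> (\<lambda>(w, A). insert w A) ` (W \<times> ?P D) \<union> ?P D"
  proof
    fix A assume "A \<in> ?P (Suc D)"
    then have A: "A \<subseteq> W" "card A \<le> Suc D" "finite A" using assms by (auto dest: finite_subset)
    show "A \<in> (\<lambda>(w, A). insert w A) ` (W \<times> ?P D) \<union> ?P D"
    proof (cases "A = {}")
      case False
      then obtain w where w: "w \<in> A" by blast
      then have "A = insert w (A - {w})" "A - {w} \<in> ?P D" "w \<in> W" using A by auto
      then have "A \<in> (\<lambda>(w, A). insert w A) ` (W \<times> ?P D)"
        by (intro image_eqI[where x = "(w, A - {w})"]) simp_all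
      then show ?thesis by blast
    qed simp
  qed
  then have "card (?P (Suc D)) \<le> card ((\<lambda>(w, A). insert w A) ` (W \<times> ?P D) \<union> ?P D)"
    using assms by (intro card_mono) auto
  also have "\<dots> \<le> card ((\<lambda>(w, A). insert w A) ` (W \<times> ?P D)) + card (?P D)"
    by (rule card_Un_le)
  also have "\<dots> \<le> card (W \<times> ?P D) + card (?P D)"
    using assms by (intro add_mono card_image_le) auto
  also have "\<dots> = (card W + 1) * card (?P D)" by (simp add: card_cartesian_product)
  also have "\<dots> \<le> (card W + 1) * (card W + 1) ^ D" using Suc by (rule mult_le_mono2)
  finally show ?case by simp
qed

text \<open>Sets shattered by the traces are shattered by \<open>\<R>\<close>, so Pajor's inequality
  leaves only subsets of \<open>W\<close> of size at most \<open>D\<close>. Polynomial growth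
  suffices, since it will compete with \<open>2 ^ k\<close>.\<close>

lemma card_traces_le:
  assumes "finite W" "\<And>A. finite A \<Longrightarrow> shatters \<R> A \<Longrightarrow> card A \<le> D"
  shows "card ((\<lambda>R. R \<inter> W) ` \<R>) \<le> (card W + 1) ^ D"
proof -
  let ?T = "(\<lambda>R. R \<inter> W) ` \<R>"
  have "card ?T \<le> card {A \<in> Pow W. shatters ?T A}"
    by (rule card_le_card_shattered) (use assms in auto)
  also have "\<dots> \<le> card {A. A \<subseteq> W \<and> card A \<le> D}"
  proof (rule card_mono)
    have "card A \<le> D" if A: "A \<subseteq> W" "shatters ?T A" for A
    proof -
      have "shatters \<R> A"
        unfolding shatters_def
      proof (intro allI impI)
        fix S assume "S \<subseteq> A"
        then obtain R where "R \<in> \<R>" "R \<inter> W \<inter> A = S"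
          using A(2) unfolding shatters_def by blast
        then show "\<exists>R\<in>\<R>. R \<inter> A = S" using A(1) by (intro bexI[of _ R]) auto
      qed
      then show ?thesis using assms A finite_subset by blast
    qed
    then show "{A \<in> Pow W. shatters ?T A} \<subseteq> {A. A \<subseteq> W \<and> card A \<le> D}" by auto
  qed (use assms in auto)
  also have "\<dots> \<le> (card W + 1) ^ D" using assms(1) by (rule card_bounded_subsets_le)
  finally show ?thesis .
qed

section \<open>Epsilon nets by double sampling\<close>

text \<open>A double sample is a sequence of \<open>s\<close> pairs, the first and the second
  entries forming the two samples. Restricting to \<open>{..<s}\<close> keeps the result in the
  extensional function space, where swapping is an involution.\<close>

definition swap_on :: "nat \<Rightarrow> nat set \<Rightarrow> (nat \<Rightarrow> 'a \<times> 'a) \<Rightarrow> nat \<Rightarrow> 'a \<times> 'a" where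
  "swap_on s \<sigma> a = (\<lambda>i\<in>{..<s}. if i \<in> \<sigma> then prod.swap (a i) else a i)"

text \<open>This is the bad event of double sampling. Both conditions concern sampled points only,
  so it depends on \<open>R\<close> only through its trace on them.\<close>

definition misses_then_hits :: "nat \<Rightarrow> nat \<Rightarrow> 'a set \<Rightarrow> (nat \<Rightarrow> 'a \<times> 'a) \<Rightarrow> bool" where
  "misses_then_hits s k R a \<longleftrightarrow> (\<forall>i<s. fst (a i) \<notin> R) \<and> k \<le> card {i. i < s \<and> snd (a i) \<in> R}"

text \<open>
  On the pairs with exactly one entry in \<open>R\<close> the set \<open>\<sigma>\<close> is forced, and there are at least
  \<open>k\<close> of them.
\<close>

lemma card_swaps_le:
  "card {\<sigma> \<in> Pow {..<s}. misses_then_hits s k R (swap_on s \<sigma> a)} * 2 ^ k \<le> 2 ^ s"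
proof (cases "{\<sigma> \<in> Pow {..<s}. misses_then_hits s k R (swap_on s \<sigma> a)} = {}")
  case False
  let ?S = "{\<sigma> \<in> Pow {..<s}. misses_then_hits s k R (swap_on s \<sigma> a)}"
  define K where "K = {i. i < s \<and> (fst (a i) \<in> R) \<noteq> (snd (a i) \<in> R)}"
  have fK: "finite K" "K \<subseteq> {..<s}" by (auto simp: K_def)
  then have cK: "card K \<le> s" by (metis card_lessThan card_mono finite_lessThan)
  have inK: "\<sigma> \<inter> K = {i \<in> K. fst (a i) \<in> R}" if "\<sigma> \<in> ?S" for \<sigma>
  proof -
    have "\<forall>i<s. fst (swap_on s \<sigma> a i) \<notin> R" using that by (simp add: misses_then_hits_def)
    then show ?thesis by (fastforce simp: swap_on_def K_def split: if_splits)
  qed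
  from False obtain \<sigma> where \<sigma>: "\<sigma> \<in> ?S" by blast
  have "k \<le> card {i. i < s \<and> snd (swap_on s \<sigma> a i) \<in> R}"
    using \<sigma> by (simp add: misses_then_hits_def)
  \<comment> \<open>Since no first entry lies in \<open>R\<close> after swapping, a position whose
    second entry does belongs to \<open>K\<close>.\<close>
  also have "\<dots> \<le> card K"
  proof (rule card_mono[OF fK(1)])
    have "\<forall>i<s. fst (swap_on s \<sigma> a i) \<notin> R" using \<sigma> by (simp add: misses_then_hits_def)
    then show "{i. i < s \<and> snd (swap_on s \<sigma> a i) \<in> R} \<subseteq> K"
      by (fastforce simp: swap_on_def K_def split: if_splits)
  qed
  finally have kK: "k \<le> card K" .
  have "card ?S = card ((\<lambda>\<sigma>. \<sigma> - K) ` ?S)"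
  proof (rule card_image[symmetric], rule inj_onI)
    fix \<sigma> \<tau> assume st: "\<sigma> \<in> ?S" "\<tau> \<in> ?S" and eq: "\<sigma> - K = \<tau> - K"
    have "\<sigma> \<inter> K = \<tau> \<inter> K" using inK[OF st(1)] inK[OF st(2)] by simp
    with eq show "\<sigma> = \<tau>" by (metis Int_Diff_Un)
  qed
  also have "\<dots> \<le> card (Pow ({..<s} - K))" by (rule card_mono) auto
  also have "\<dots> = 2 ^ (s - card K)" using fK by (simp add: card_Pow card_Diff_subset)
  finally have "card ?S * 2 ^ k \<le> 2 ^ (s - card K) * 2 ^ card K"
    using kK by (intro mult_mono) auto
  also have "\<dots> = 2 ^ s" using cK by (simp flip: power_add)
  finally show ?thesis .
next
  case True
  then show ?thesis by (simp only: card.empty)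
qed

text \<open>For fixed \<open>a\<close> at most \<open>2 * s\<close> points are sampled. A union
  bound over the polynomially many traces on them replaces one over all of
  \<open>\<R>\<close>.\<close>

lemma card_bad_swaps_le:
  assumes vc: "\<And>A. finite A \<Longrightarrow> shatters \<R> A \<Longrightarrow> card A \<le> D"
  shows "card {\<sigma> \<in> Pow {..<s}. \<exists>R\<in>\<R>. misses_then_hits s k R (swap_on s \<sigma> a)} * 2 ^ k
    \<le> (2 * s + 1) ^ D * 2 ^ s"
proof -
  define W where "W = (\<lambda>i. fst (a i)) ` {..<s} \<union> (\<lambda>i. snd (a i)) ` {..<s}"
  let ?S = "\<lambda>R. {\<sigma> \<in> Pow {..<s}. misses_then_hits s k R (swap_on s \<sigma> a)}"
  let ?T = "(\<lambda>R. R \<inter> W) ` \<R>"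
  have fW: "finite W" by (simp add: W_def)
  have "card W \<le> card ((\<lambda>i. fst (a i)) ` {..<s}) + card ((\<lambda>i. snd (a i)) ` {..<s})"
    unfolding W_def by (rule card_Un_le)
  also have "\<dots> \<le> card {..<s} + card {..<s}" by (intro add_mono card_image_le) auto
  finally have cW: "card W \<le> 2 * s" by simp
  have fT: "finite ?T" by (rule finite_subset[of _ "Pow W"]) (use fW in auto)
  have tr: "misses_then_hits s k (R \<inter> W) (swap_on s \<sigma> a) \<longleftrightarrow> misses_then_hits s k R (swap_on s \<sigma> a)"
    for R \<sigma>
  proof -
    have "fst (swap_on s \<sigma> a i) \<in> W" "snd (swap_on s \<sigma> a i) \<in> W" if "i < s" for i
      using that by (auto simp: swap_on_def W_def)
    then show ?thesis by (auto simp: misses_then_hits_def cong: conj_cong)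
  qed
  have "{\<sigma> \<in> Pow {..<s}. \<exists>R\<in>\<R>. misses_then_hits s k R (swap_on s \<sigma> a)} = (\<Union>R\<in>?T. ?S R)"
    by (auto simp: tr)
  then have "card {\<sigma> \<in> Pow {..<s}. \<exists>R\<in>\<R>. misses_then_hits s k R (swap_on s \<sigma> a)} * 2 ^ k
      \<le> (\<Sum>R\<in>?T. card (?S R)) * 2 ^ k"
    using card_UN_le[OF fT, of ?S] by simp
  also have "\<dots> = (\<Sum>R\<in>?T. card (?S R) * 2 ^ k)" by (rule sum_distrib_right)
  also have "\<dots> \<le> card ?T * 2 ^ s"
    using sum_bounded_above[of ?T "\<lambda>R. card (?S R) * 2 ^ k" "2 ^ s", OF card_swaps_le]
    by (simp only: of_nat_id)
  also have "card ?T \<le> (card W + 1) ^ D" by (rule card_traces_le[OF fW vc])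
  also have "(card W + 1) ^ D \<le> (2 * s + 1) ^ D" using cW by (intro power_mono) auto
  finally show ?thesis by simp
qed

lemma card_filter_swap:
  assumes "finite A" "finite B"
  shows "(\<Sum>a\<in>A. card {b \<in> B. P a b}) = (\<Sum>b\<in>B. card {a \<in> A. P a b})"
proof -
  have "(\<Sum>a\<in>A. \<Sum>b\<in>B. if P a b then 1 else 0 :: nat) = (\<Sum>b\<in>B. \<Sum>a\<in>A. if P a b then 1 else 0)"
    by (rule sum.swap)
  then show ?thesis using assms by (simp add: sum.If_cases Int_def)
qed

text \<open>Symmetrization: each fixed \<open>\<sigma>\<close> permutes the double samples, so
  swapping leaves the number of bad ones unchanged. Averaging over all \<open>\<sigma>\<close> and
  exchanging the sums reduces the count to the bound on swaps of a single \<open>a\<close>.\<close>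

lemma card_bad_pairs_le:
  assumes "finite X" and vc: "\<And>A. finite A \<Longrightarrow> shatters \<R> A \<Longrightarrow> card A \<le> D"
  shows "card {a \<in> {..<s} \<rightarrow>\<^sub>E X \<times> X. \<exists>R\<in>\<R>. misses_then_hits s k R a} * 2 ^ k
    \<le> (2 * s + 1) ^ D * card X ^ (2 * s)"
proof -
  let ?A = "{..<s} \<rightarrow>\<^sub>E X \<times> X"
  let ?bad = "\<lambda>a. \<exists>R\<in>\<R>. misses_then_hits s k R a"
  have fA: "finite ?A" using assms by (intro finite_PiE) auto
  have cA: "card ?A = card X ^ (2 * s)"
    by (simp add: card_PiE card_cartesian_product power_mult power2_eq_square)
  have inv: "swap_on s \<sigma> (swap_on s \<sigma> a) = a" if "a \<in> ?A" for \<sigma> a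
    using that by (auto simp: swap_on_def fun_eq_iff PiE_def extensional_def)
  have swp: "swap_on s \<sigma> a \<in> ?A" if "a \<in> ?A" for \<sigma> a
    using that by (auto simp: swap_on_def PiE_iff mem_Times_iff)
  have "card {a \<in> ?A. ?bad (swap_on s \<sigma> a)} = card {a \<in> ?A. ?bad a}" for \<sigma>
    by (rule bij_betw_same_card[of "swap_on s \<sigma>"])
      (rule bij_betw_byWitness[of _ "swap_on s \<sigma>"]; simp add: inv swp image_subset_iff)
  then have "card {a \<in> ?A. ?bad a} * 2 ^ s
      = (\<Sum>\<sigma>\<in>Pow {..<s}. card {a \<in> ?A. ?bad (swap_on s \<sigma> a)})"
    by (simp add: card_Pow)
  also have "\<dots> = (\<Sum>a\<in>?A. card {\<sigma> \<in> Pow {..<s}. ?bad (swap_on s \<sigma> a)})"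
    by (rule card_filter_swap) (use fA in auto)
  finally have "card {a \<in> ?A. ?bad a} * 2 ^ s * 2 ^ k
      = (\<Sum>a\<in>?A. card {\<sigma> \<in> Pow {..<s}. ?bad (swap_on s \<sigma> a)} * 2 ^ k)"
    by (simp add: sum_distrib_right)
  also have "\<dots> \<le> card ?A * ((2 * s + 1) ^ D * 2 ^ s)"
    using sum_bounded_above[of ?A "\<lambda>a. card {\<sigma> \<in> Pow {..<s}. ?bad (swap_on s \<sigma> a)} * 2 ^ k"
      "(2 * s + 1) ^ D * 2 ^ s", OF card_bad_swaps_le[OF vc]] by (simp only: of_nat_id)
  finally show ?thesis using cA by (simp add: ac_simps)
qed

text \<open>A reverse Markov argument. The mean number of hits is at least
  \<open>\<epsilon> * s\<close>. Samples with fewer than \<open>k\<close> hits account for at most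
  \<open>\<epsilon> * s / 2\<close> of it, so the others, with at most \<open>s\<close> hits each,
  form a proportion of at least \<open>\<epsilon> / 2\<close>.\<close>

lemma card_hitting_samples_ge:
  fixes \<epsilon> :: real
  assumes "finite X" "R \<subseteq> X" "\<epsilon> * card X \<le> card R" "0 < s" "real k \<le> \<epsilon> * s / 2"
  shows "\<epsilon> / 2 * card X ^ s \<le> card {y \<in> {..<s} \<rightarrow>\<^sub>E X. k \<le> card {i. i < s \<and> y i \<in> R}}"
proof -
  let ?Y = "{..<s} \<rightarrow>\<^sub>E X"
  let ?h = "\<lambda>y. card {i. i < s \<and> y i \<in> R}"
  let ?G = "{y \<in> ?Y. k \<le> ?h y}"
  have fY: "finite ?Y" using assms by (intro finite_PiE) auto
  have cY: "card ?Y = card X ^ s" by (simp add: card_PiE)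
  have "card {y \<in> ?Y. y i \<in> R} = card R * card X ^ (s - 1)" if "i < s" for i
  proof -
    have "{y \<in> ?Y. y i \<in> R} = (\<Pi>\<^sub>E j\<in>{..<s}. if j = i then R else X)"
    proof (intro set_eqI iffI)
      fix y assume *: "y \<in> (\<Pi>\<^sub>E j\<in>{..<s}. if j = i then R else X)"
      have y: "y j \<in> (if j = i then R else X)" if "j < s" for j
        using PiE_mem[OF *, of j] that by simp
      then have "y j \<in> X" if "j < s" for j
        using y[OF that] assms(2) by (auto split: if_splits)
      then show "y \<in> {y \<in> ?Y. y i \<in> R}"
        using y[of i] \<open>i < s\<close> * by (simp add: PiE_def Pi_iff)
    qed (auto simp: PiE_iff)
    also have "card \<dots> = (\<Prod>j<s. card (if j = i then R else X))" by (simp add: card_PiE)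
    also have "\<dots> = card R * (\<Prod>j\<in>{..<s} - {i}. card (if j = i then R else X))"
      using that by (subst prod.remove[of _ i]) auto
    also have "(\<Prod>j\<in>{..<s} - {i}. card (if j = i then R else X)) = (\<Prod>j\<in>{..<s} - {i}. card X)"
      by (rule prod.cong) auto
    finally show ?thesis using that by simp
  qed
  then have "s * (card R * card X ^ (s - 1)) = (\<Sum>i<s. card {y \<in> ?Y. y i \<in> R})" by simp
  also have "\<dots> = (\<Sum>y\<in>?Y. card {i \<in> {..<s}. y i \<in> R})"
    by (rule card_filter_swap) (use fY in auto)
  finally have "real (s * (card R * card X ^ (s - 1))) = (\<Sum>y\<in>?Y. real (?h y))" by simp
  also have "\<dots> \<le> (\<Sum>y\<in>?Y. (if y \<in> ?G then real s else 0) + \<epsilon> * s / 2)"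
  proof (rule sum_mono)
    fix y assume y: "y \<in> ?Y"
    have "?h y \<le> card {..<s}" by (rule card_mono) auto
    moreover have "0 \<le> \<epsilon> * s / 2" using assms(5) by (meson of_nat_0_le_iff order_trans)
    ultimately show "real (?h y) \<le> (if y \<in> ?G then real s else 0) + \<epsilon> * s / 2"
      using y assms(5) by auto
  qed
  also have "\<dots> = s * real (card ?G) + card X ^ s * (\<epsilon> * s / 2)"
    using fY by (simp add: sum.distrib cY sum.If_cases Int_def mult.commute)
  finally have *: "s * (card R * real (card X) ^ (s - 1)) \<le> s * real (card ?G) + card X ^ s * (\<epsilon> * s / 2)"
    by simp
  have "\<epsilon> * real (card X) ^ s = \<epsilon> * card X * real (card X) ^ (s - 1)"
    using assms(4) by (cases s) auto
  also have "\<dots> \<le> card R * real (card X) ^ (s - 1)" using assms(3) by (intro mult_right_mono) auto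
  finally have "s * (\<epsilon> * real (card X) ^ s) \<le> s * real (card ?G) + card X ^ s * (\<epsilon> * s / 2)"
    using * by (smt (verit) mult_left_mono of_nat_0_le_iff)
  then have "s * (\<epsilon> / 2 * real (card X) ^ s) \<le> s * real (card ?G)" by (simp add: field_simps)
  then show ?thesis using assms(4) by simp
qed

text \<open>Without a net of size \<open>s\<close>, each first sample \<open>x\<close> misses some
  range \<open>r x\<close>, while a proportion \<open>\<epsilon> / 2\<close> of the second samples
  hits it at least \<open>k\<close> times. This produces more bad double samples than symmetrization
  allows.\<close>

lemma net_of_sample_size:
  fixes \<epsilon> :: real
  assumes X: "finite X" "X \<noteq> {}" and \<R>: "\<And>R. R \<in> \<R> \<Longrightarrow> R \<subseteq> X \<and> \<epsilon> * card X \<le> card R"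
    and vc: "\<And>A. finite A \<Longrightarrow> shatters \<R> A \<Longrightarrow> card A \<le> D"
    and s: "0 < s" "real k \<le> \<epsilon> * s / 2" "real ((2 * s + 1) ^ D) < \<epsilon> / 2 * 2 ^ k"
  shows "\<exists>N\<subseteq>X. card N \<le> s \<and> (\<forall>R\<in>\<R>. R \<inter> N \<noteq> {})"
proof (rule ccontr)
  assume neg: "\<not> ?thesis"
  let ?Y = "{..<s} \<rightarrow>\<^sub>E X"
  have "\<exists>R\<in>\<R>. \<forall>i<s. x i \<notin> R" if "x \<in> ?Y" for x
  proof -
    have "x ` {..<s} \<subseteq> X" using that by auto
    moreover have "card (x ` {..<s}) \<le> s" using card_image_le[of "{..<s}" x] by simp
    ultimately have "\<exists>R\<in>\<R>. R \<inter> x ` {..<s} = {}" using neg by blast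
    then show ?thesis by blast
  qed
  then obtain r where r: "\<And>x. x \<in> ?Y \<Longrightarrow> r x \<in> \<R> \<and> (\<forall>i<s. x i \<notin> r x)" by metis
  let ?H = "\<lambda>x. {y \<in> ?Y. k \<le> card {i. i < s \<and> y i \<in> r x}}"
  let ?B = "{a \<in> {..<s} \<rightarrow>\<^sub>E X \<times> X. \<exists>R\<in>\<R>. misses_then_hits s k R a}"
  let ?pair = "\<lambda>(x, y). \<lambda>i\<in>{..<s}. (x i, y i)"
  have fY: "finite ?Y" using X by (intro finite_PiE) auto
  have "finite ({..<s} \<rightarrow>\<^sub>E X \<times> X)" using X by (intro finite_PiE) auto
  then have fB: "finite ?B" by simp
  have "real (card X) ^ (2 * s) * (\<epsilon> / 2) = (\<Sum>x\<in>?Y. \<epsilon> / 2 * card X ^ s)"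
    by (simp add: card_PiE mult_2 power_add)
  also have "\<dots> \<le> (\<Sum>x\<in>?Y. real (card (?H x)))"
  proof (rule sum_mono)
    fix x assume "x \<in> ?Y"
    then have "r x \<subseteq> X" "\<epsilon> * card X \<le> card (r x)" using \<R> r by blast+
    then show "\<epsilon> / 2 * card X ^ s \<le> real (card (?H x))"
      using card_hitting_samples_ge[OF X(1) _ _ s(1,2)] by blast
  qed
  also have "\<dots> = real (card (Sigma ?Y ?H))" using fY by (simp add: card_SigmaI)
  also have "\<dots> = real (card (?pair ` Sigma ?Y ?H))"
  proof (subst card_image)
    show "inj_on ?pair (Sigma ?Y ?H)"
    proof (rule inj_onI)
      fix u v assume uv: "u \<in> Sigma ?Y ?H" "v \<in> Sigma ?Y ?H" "?pair u = ?pair v"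
      obtain x y x' y' where xy: "u = (x, y)" "v = (x', y')" by (metis surj_pair)
      have *: "x \<in> ?Y" "y \<in> ?Y" "x' \<in> ?Y" "y' \<in> ?Y"
        "(\<lambda>i\<in>{..<s}. (x i, y i)) = (\<lambda>i\<in>{..<s}. (x' i, y' i))"
        using uv unfolding xy by simp_all
      have "x i = x' i \<and> y i = y' i" if "i < s" for i
        using fun_cong[OF *(5), of i] that by simp
      then have "x = x'" "y = y'"
        using PiE_ext[OF *(1,3)] PiE_ext[OF *(2,4)] by auto
      then show "u = v" by (simp add: xy)
    qed
  qed simp
  also have "\<dots> \<le> real (card ?B)"
  proof (intro of_nat_mono card_mono fB subsetI)
    fix a assume "a \<in> ?pair ` Sigma ?Y ?H"
    then obtain x y where a: "a = (\<lambda>i\<in>{..<s}. (x i, y i))"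
      and *: "x \<in> ?Y" "y \<in> ?Y" "k \<le> card {i. i < s \<and> y i \<in> r x}" by auto
    have "misses_then_hits s k (r x) (\<lambda>i\<in>{..<s}. (x i, y i))"
      using *(3) r[OF *(1)] by (auto simp: misses_then_hits_def cong: conj_cong)
    moreover have "a \<in> {..<s} \<rightarrow>\<^sub>E X \<times> X" unfolding a using * by (auto simp: PiE_iff)
    ultimately show "a \<in> ?B" unfolding a using r[OF *(1)] by blast
  qed
  finally have "real (card X) ^ (2 * s) * (\<epsilon> / 2) * 2 ^ k \<le> real (card ?B) * 2 ^ k"
    by (intro mult_right_mono) auto
  also have "\<dots> = real (card ?B * 2 ^ k)" by simp
  also have "\<dots> \<le> real ((2 * s + 1) ^ D * card X ^ (2 * s))"
    using card_bad_pairs_le[OF X(1) vc] by (rule of_nat_mono)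
  finally have "real (card X) ^ (2 * s) * (\<epsilon> / 2 * 2 ^ k) \<le> real (card X) ^ (2 * s) * real ((2 * s + 1) ^ D)"
    by (simp add: ac_simps)
  moreover have "0 < real (card X) ^ (2 * s)" using X by (simp add: card_gt_0_iff)
  ultimately have "\<epsilon> / 2 * 2 ^ k \<le> real ((2 * s + 1) ^ D)" by (simp only: mult_le_cancel_left_pos)
  with s(3) show False by simp
qed

text \<open>With \<open>s = q * k\<close> and \<open>q \<ge> 2 / \<epsilon>\<close> the bound on
  \<open>k\<close> is automatic, and the last condition holds for large \<open>k\<close> because
  \<open>2 ^ k\<close> outgrows the polynomial.\<close>

lemma sample_size_exists:
  fixes \<epsilon> :: real
  assumes "0 < \<epsilon>"
  shows "\<exists>s k. 0 < s \<and> real k \<le> \<epsilon> * s / 2 \<and> real ((2 * s + 1) ^ D) < \<epsilon> / 2 * 2 ^ k"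
proof -
  define q where "q = nat \<lceil>2 / \<epsilon>\<rceil>"
  have q: "2 / \<epsilon> \<le> q" "0 < q" using assms by (auto simp: q_def)
  \<comment> \<open>\<open>2 ^ k\<close> is written as \<open>exp (ln 2 * k)\<close> in order to use
    the known limit of a power over an exponential.\<close>
  have "filterlim (\<lambda>k. ln 2 * real k) at_top sequentially"
    by (intro filterlim_tendsto_pos_mult_at_top[OF tendsto_const] filterlim_real_sequentially) simp
  from filterlim_compose[OF tendsto_power_div_exp_0 this]
  have "(\<lambda>k. (ln 2 * real k) ^ D / exp (ln 2 * real k)) \<longlonglongrightarrow> 0" .
  then have "(\<lambda>k. (1 / ln 2) ^ D * ((ln 2 * real k) ^ D / exp (ln 2 * real k))) \<longlonglongrightarrow> (1 / ln 2) ^ D * 0"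
    by (rule tendsto_mult_left)
  moreover have "(1 / ln 2) ^ D * ((ln 2 * real k) ^ D / exp (ln 2 * real k)) = real k ^ D * (1/2) ^ k" for k
    by (simp add: power_mult_distrib power_divide exp_of_nat2_mult divide_simps)
  ultimately have "(\<lambda>k. real k ^ D * (1/2) ^ k) \<longlonglongrightarrow> 0" by simp
  then have "(\<lambda>k. (real (3 * q)) ^ D * (real k ^ D * (1/2) ^ k)) \<longlonglongrightarrow> (real (3 * q)) ^ D * 0"
    by (rule tendsto_mult_left)
  then have "\<forall>\<^sub>F k in sequentially. (real (3 * q)) ^ D * (real k ^ D * (1/2) ^ k) < \<epsilon> / 2"
    using assms by (intro order_tendstoD) auto
  then have "\<forall>\<^sub>F k in sequentially. (real (3 * q)) ^ D * (real k ^ D * (1/2) ^ k) < \<epsilon> / 2 \<and> 0 < k"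
    by (intro eventually_conj eventually_gt_at_top)
  then obtain k where k: "(real (3 * q)) ^ D * (real k ^ D * (1/2) ^ k) < \<epsilon> / 2" "0 < k"
    using eventually_happens'[OF sequentially_bot] by blast
  have "1 \<le> q * k" using k q by (simp add: Suc_le_eq)
  then have "2 * (q * k) + 1 \<le> 3 * q * k" by linarith
  then have "real ((2 * (q * k) + 1) ^ D) \<le> (real (3 * q * k)) ^ D"
    by (metis of_nat_le_iff of_nat_power power_mono zero_le)
  also have "\<dots> = (real (3 * q)) ^ D * (real k ^ D * (1/2) ^ k) * 2 ^ k"
    by (simp add: power_mult_distrib power_divide)
  also have "\<dots> < \<epsilon> / 2 * 2 ^ k" using k by (intro mult_strict_right_mono) auto
  finally have 1: "real ((2 * (q * k) + 1) ^ D) < \<epsilon> / 2 * 2 ^ k" .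
  have "2 \<le> \<epsilon> * q" using q(1) assms by (simp add: field_simps)
  then have "real k * 2 \<le> real k * (\<epsilon> * q)" by (intro mult_left_mono) auto
  then have 2: "real k \<le> \<epsilon> * real (q * k) / 2" by (simp add: ac_simps)
  show ?thesis using 1 2 q k by (intro exI[of _ "q * k"] exI[of _ k]) auto
qed

text \<open>The size \<open>s\<close> is chosen before \<open>X\<close> and \<open>\<R>\<close>;
  this uniformity is what makes the final number of subspaces a constant.\<close>

theorem epsilon_net:
  fixes \<epsilon> :: real and D :: nat
  assumes "0 < \<epsilon>"
  shows "\<exists>s. \<forall>(X :: 'a set) \<R>. finite X \<longrightarrow> X \<noteq> {} \<longrightarrow> (\<forall>R\<in>\<R>. R \<subseteq> X \<and> \<epsilon> * card X \<le> card R) \<longrightarrow>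
    (\<forall>A. finite A \<longrightarrow> shatters \<R> A \<longrightarrow> card A \<le> D) \<longrightarrow>
    (\<exists>N\<subseteq>X. card N \<le> s \<and> (\<forall>R\<in>\<R>. R \<inter> N \<noteq> {}))"
proof -
  obtain s k where "0 < s" "real k \<le> \<epsilon> * s / 2" "real ((2 * s + 1) ^ D) < \<epsilon> / 2 * 2 ^ k"
    using sample_size_exists[OF assms] by blast
  then show ?thesis by (intro exI[of _ s] allI impI net_of_sample_size[of _ _ \<epsilon> D s k]) auto
qed

section \<open>Weighted rainbow tuples\<close>

lemma sum_PiE_split:
  assumes "j \<in> I"
  shows "(\<Sum>f\<in>Pi\<^sub>E I F. h f) = (\<Sum>g\<in>Pi\<^sub>E (I - {j}) F. \<Sum>y\<in>F j. h (g(j := y)))"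
proof -
  have "Pi\<^sub>E I F = (\<lambda>(y, g). g(j := y)) ` (F j \<times> Pi\<^sub>E (I - {j}) F)"
    using PiE_insert_eq[of j "I - {j}" F] assms by (simp add: insert_absorb)
  then have "(\<Sum>f\<in>Pi\<^sub>E I F. h f) = (\<Sum>(y, g)\<in>F j \<times> Pi\<^sub>E (I - {j}) F. h (g(j := y)))"
    using inj_combinator[of j "I - {j}" F] by (simp add: sum.reindex case_prod_unfold)
  also have "\<dots> = (\<Sum>y\<in>F j. \<Sum>g\<in>Pi\<^sub>E (I - {j}) F. h (g(j := y)))"
    by (rule sum.cartesian_product[symmetric])
  also have "\<dots> = (\<Sum>g\<in>Pi\<^sub>E (I - {j}) F. \<Sum>y\<in>F j. h (g(j := y)))"
    by (rule sum.swap)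
  finally show ?thesis .
qed

text \<open>Choose a tuple at random, coordinate \<open>i\<close> with probability proportional to
  \<open>w i\<close>. The first condition on \<open>\<G>\<close> makes the candidates for
  \<open>j\<close> independent of the coordinate \<open>f j\<close>. If every candidate met too
  little weight, the expected number of candidates hitting their own coordinate would be below 1,
  but every tuple has one.\<close>

lemma colorful_fractional:
  fixes F :: "'i \<Rightarrow> 'b set" and w :: "'i \<Rightarrow> 'b \<Rightarrow> real" and hit :: "'v \<Rightarrow> 'b \<Rightarrow> bool"
    and \<G> :: "'i \<Rightarrow> ('i \<Rightarrow> 'b) \<Rightarrow> 'v set"
  assumes I: "finite I" and F: "\<And>i. i \<in> I \<Longrightarrow> finite (F i) \<and> F i \<noteq> {}"
    and w: "\<And>i b. 0 < w i b"
    and \<G>: "\<And>j f y. \<G> j (f(j := y)) = \<G> j f"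
      "\<And>j f. j \<in> I \<Longrightarrow> finite (\<G> j f) \<and> card (\<G> j f) \<le> M"
    and hits: "\<And>f. f \<in> Pi\<^sub>E I F \<Longrightarrow> \<exists>j\<in>I. \<exists>V\<in>\<G> j f. hit V (f j)"
  shows "\<exists>i\<in>I. \<exists>f. \<exists>V\<in>\<G> i f. sum (w i) (F i) \<le> (card I * M + 1) * sum (w i) {b \<in> F i. hit V b}"
proof (rule ccontr)
  assume neg: "\<not> ?thesis"
  define N where "N = real (card I * M + 1)"
  define W where "W i = sum (w i) (F i)" for i
  define P where "P = (\<Prod>i\<in>I. W i)"
  define ind where "ind V b = (if hit V b then 1 else 0 :: real)" for V b
  define pw where "pw f = (\<Prod>i\<in>I. w i (f i))" for f
  have N: "0 < N" unfolding N_def of_nat_0_less_iff by simp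
  have W: "0 < W i" if "i \<in> I" for i
    unfolding W_def using F[OF that] w by (intro sum_pos) auto
  have P: "0 < P" unfolding P_def using W by (rule prod_pos)
  have small: "(\<Sum>y\<in>F j. w j y * (\<Sum>V\<in>\<G> j g. ind V y)) \<le> M * (W j / N)" if j: "j \<in> I" for j g
  proof -
    have "(\<Sum>y\<in>F j. w j y * (\<Sum>V\<in>\<G> j g. ind V y)) = (\<Sum>V\<in>\<G> j g. \<Sum>y\<in>F j. w j y * ind V y)"
      unfolding sum_distrib_left by (rule sum.swap)
    also have "\<dots> \<le> (\<Sum>V\<in>\<G> j g. W j / N)"
    proof (rule sum_mono)
      fix V assume V: "V \<in> \<G> j g"
      have "(\<Sum>y\<in>F j. w j y * ind V y) = sum (w j) {b \<in> F j. hit V b}"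
        using F[OF j] by (simp add: ind_def if_distrib sum.If_cases Int_def cong: if_cong)
      moreover have "N * sum (w j) {b \<in> F j. hit V b} \<le> W j"
        using neg j V unfolding N_def W_def by (meson linear)
      ultimately show "(\<Sum>y\<in>F j. w j y * ind V y) \<le> W j / N"
        using N by (simp add: pos_le_divide_eq mult.commute)
    qed
    also have "\<dots> = card (\<G> j g) * (W j / N)" by simp
    also have "\<dots> \<le> M * (W j / N)"
      using \<G>(2)[OF j, of g] W[OF j] N by (intro mult_right_mono) auto
    finally show ?thesis .
  qed
  have "P = (\<Sum>f\<in>Pi\<^sub>E I F. pw f)"
    unfolding P_def W_def pw_def using I F by (intro prod_sum_PiE) auto
  also have "\<dots> \<le> (\<Sum>f\<in>Pi\<^sub>E I F. \<Sum>j\<in>I. pw f * (\<Sum>V\<in>\<G> j f. ind V (f j)))"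
  proof (rule sum_mono)
    fix f assume "f \<in> Pi\<^sub>E I F"
    then obtain j V where j: "j \<in> I" "V \<in> \<G> j f" "hit V (f j)" using hits by blast
    have pw: "0 \<le> pw f" unfolding pw_def using w by (intro prod_nonneg) (simp add: less_imp_le)
    have "1 = ind V (f j)" using j by (simp add: ind_def)
    also have "\<dots> \<le> (\<Sum>V\<in>\<G> j f. ind V (f j))"
      using j \<G>(2) by (intro member_le_sum) (auto simp: ind_def)
    finally have "pw f * 1 \<le> pw f * (\<Sum>V\<in>\<G> j f. ind V (f j))" using pw by (rule mult_left_mono)
    also have "\<dots> \<le> (\<Sum>j\<in>I. pw f * (\<Sum>V\<in>\<G> j f. ind V (f j)))"
      using j I pw by (intro member_le_sum[of j I "\<lambda>j. pw f * (\<Sum>V\<in>\<G> j f. ind V (f j))"])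
        (auto simp: ind_def intro!: mult_nonneg_nonneg sum_nonneg)
    finally show "pw f \<le> (\<Sum>j\<in>I. pw f * (\<Sum>V\<in>\<G> j f. ind V (f j)))" by simp
  qed
  also have "\<dots> = (\<Sum>j\<in>I. \<Sum>f\<in>Pi\<^sub>E I F. pw f * (\<Sum>V\<in>\<G> j f. ind V (f j)))" by (rule sum.swap)
  also have "\<dots> \<le> (\<Sum>j\<in>I. M * (P / N))"
  proof (rule sum_mono)
    fix j assume j: "j \<in> I"
    let ?q = "\<lambda>g. \<Prod>i\<in>I - {j}. w i (g i)"
    have pwj: "pw (g(j := y)) = w j y * ?q g" for g y
    proof -
      have "(\<Prod>i\<in>I - {j}. w i ((g(j := y)) i)) = ?q g" by (rule prod.cong) auto
      then show ?thesis
        unfolding pw_def using prod.remove[OF I j, of "\<lambda>i. w i ((g(j := y)) i)"] by simp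
    qed
    \<comment> \<open>Coordinate \<open>j\<close> is summed first, with the candidates
      \<open>\<G> j g\<close> held fixed; here their independence of \<open>f j\<close>
      enters.\<close>
    have "(\<Sum>f\<in>Pi\<^sub>E I F. pw f * (\<Sum>V\<in>\<G> j f. ind V (f j)))
        = (\<Sum>g\<in>Pi\<^sub>E (I - {j}) F. ?q g * (\<Sum>y\<in>F j. w j y * (\<Sum>V\<in>\<G> j g. ind V y)))"
      unfolding sum_PiE_split[OF j] pwj \<G>(1) fun_upd_same sum_distrib_left[of "?q _" _ "F j"]
      by (simp only: ac_simps)
    also have "\<dots> \<le> (\<Sum>g\<in>Pi\<^sub>E (I - {j}) F. ?q g * (M * (W j / N)))"
      using w small[OF j] by (intro sum_mono mult_left_mono prod_nonneg) (auto simp: less_imp_le)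
    also have "\<dots> = (\<Prod>i\<in>I - {j}. W i) * (M * (W j / N))"
    proof -
      have "(\<Prod>i\<in>I - {j}. W i) = (\<Sum>g\<in>Pi\<^sub>E (I - {j}) F. ?q g)"
        unfolding W_def using I F by (intro prod_sum_PiE) auto
      then show ?thesis by (simp only: sum_distrib_right)
    qed
    also have "\<dots> = M * (P / N)" unfolding P_def using prod.remove[OF I j, of W] by simp
    finally show "(\<Sum>f\<in>Pi\<^sub>E I F. pw f * (\<Sum>V\<in>\<G> j f. ind V (f j))) \<le> M * (P / N)" .
  qed
  also have "\<dots> = card I * M * P / N" by simp
  \<comment> \<open>\<open>N\<close> exceeds \<open>card I * M\<close> by one, which makes the
    inequality strict.\<close>
  also have "\<dots> < P"
    using N P by (simp add: N_def pos_divide_less_eq algebra_simps)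
  finally show False by simp
qed

section \<open>From weighted fractions to a sequence hitting every member often\<close>

lemma exists_of_sum_ge:
  fixes l :: "'i \<Rightarrow> nat"
  assumes "finite I" "card I * L < (\<Sum>i\<in>I. l i)"
  shows "\<exists>i\<in>I. L \<le> l i"
proof (rule ccontr)
  assume "\<not> ?thesis"
  then have "(\<Sum>i\<in>I. l i) \<le> (\<Sum>i\<in>I. L)" by (intro sum_mono) force
  with assms show False by simp
qed

text \<open>In each round one family has its hit members halved in weight, which multiplies its
  total by at most \<open>1 - \<beta> / 2\<close>. A member hit \<open>c\<close> times still weighs
  \<open>(1/2) ^ c\<close>, so after many rounds for that family \<open>c\<close> is at least
  proportional to their number. The outcome is a list because repetitions count.\<close>

lemma multiplicative_weights:
  fixes F :: "'i \<Rightarrow> 'b set" and hit :: "'v \<Rightarrow> 'b \<Rightarrow> bool" and \<beta> :: real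
  assumes I: "finite I" "I \<noteq> {}" and F: "\<And>i. i \<in> I \<Longrightarrow> finite (F i) \<and> F i \<noteq> {}"
    and \<beta>: "0 < \<beta>" "\<beta> \<le> 1"
    and frac: "\<And>w :: 'i \<Rightarrow> 'b \<Rightarrow> real. (\<And>i b. 0 < w i b) \<Longrightarrow>
      \<exists>i\<in>I. \<exists>V\<in>P. \<beta> * sum (w i) (F i) \<le> sum (w i) {b \<in> F i. hit V b}"
  shows "\<exists>i\<in>I. \<exists>xs. xs \<noteq> [] \<and> set xs \<subseteq> P \<and>
    (\<forall>b\<in>F i. \<beta> / 4 * length xs \<le> length (filter (\<lambda>V. hit V b) xs))"
proof -
  define cnt where "cnt b xs = length (filter (\<lambda>V. hit V b) xs)" for b xs
  define wt where "wt xs b = (1/2 :: real) ^ cnt b xs" for xs b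
  have step: "\<exists>h :: 'i \<Rightarrow> 'v list. (\<Sum>i\<in>I. length (h i)) = T \<and> (\<forall>i\<in>I. set (h i) \<subseteq> P) \<and>
      (\<forall>i\<in>I. sum (wt (h i)) (F i) \<le> card (F i) * (1 - \<beta> / 2) ^ length (h i))" for T
  proof (induction T)
    case 0
    show ?case by (rule exI[of _ "\<lambda>_. []"]) (simp add: wt_def cnt_def)
  next
    case (Suc T)
    then obtain h :: "'i \<Rightarrow> 'v list" where h: "(\<Sum>i\<in>I. length (h i)) = T"
      "\<And>i. i \<in> I \<Longrightarrow> set (h i) \<subseteq> P"
      "\<And>i. i \<in> I \<Longrightarrow> sum (wt (h i)) (F i) \<le> card (F i) * (1 - \<beta> / 2) ^ length (h i)"
      by blast
    \<comment> \<open>The current weights of all families enter at once; only the family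
      \<open>j\<close> that is found extends its list.\<close>
    obtain j V where j: "j \<in> I" "V \<in> P"
      "\<beta> * sum (wt (h j)) (F j) \<le> sum (wt (h j)) {b \<in> F j. hit V b}"
      using frac[of "\<lambda>i. wt (h i)"] by (auto simp: wt_def)
    have "wt (V # h j) b = wt (h j) b - (if hit V b then wt (h j) b / 2 else 0)" for b
      by (simp add: wt_def cnt_def)
    then have "sum (wt (V # h j)) (F j) = sum (wt (h j)) (F j) - sum (wt (h j)) {b \<in> F j. hit V b} / 2"
      using F[OF j(1)] by (simp add: sum_subtractf sum.If_cases Int_def sum_divide_distrib)
    also have "\<dots> \<le> sum (wt (h j)) (F j) * (1 - \<beta> / 2)" using j(3) by (simp add: algebra_simps)
    also have "\<dots> \<le> card (F j) * (1 - \<beta> / 2) ^ length (h j) * (1 - \<beta> / 2)"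
      using h(3)[OF j(1)] \<beta> by (intro mult_right_mono) auto
    finally have new: "sum (wt (V # h j)) (F j) \<le> card (F j) * (1 - \<beta> / 2) ^ Suc (length (h j))"
      by (simp add: ac_simps)
    have "(\<Sum>i\<in>I. length ((h(j := V # h j)) i)) = Suc T"
    proof -
      have "(\<Sum>i\<in>I - {j}. length ((h(j := V # h j)) i)) = (\<Sum>i\<in>I - {j}. length (h i))"
        by (rule sum.cong) auto
      then show ?thesis
        using h(1) sum.remove[OF I(1) j(1), of "\<lambda>i. length (h i)"]
          sum.remove[OF I(1) j(1), of "\<lambda>i. length ((h(j := V # h j)) i)"] by simp
    qed
    then show ?case
      using new h j by (intro exI[of _ "h(j := V # h j)"]) auto
  qed
  \<comment> \<open>From this length on \<open>card (F i) \<le> exp (\<beta> * l / 4)\<close>, so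
    the initial weight costs only half of the exponent \<open>\<beta> * l / 2\<close>.
    \<open>Suc\<close> keeps the chosen list nonempty.\<close>
  define L where "L = Suc (\<Sum>i\<in>I. nat \<lceil>4 * ln (card (F i)) / \<beta>\<rceil>)"
  obtain h :: "'i \<Rightarrow> 'v list" where h: "(\<Sum>i\<in>I. length (h i)) = card I * L + 1"
      "\<And>i. i \<in> I \<Longrightarrow> set (h i) \<subseteq> P"
      "\<And>i. i \<in> I \<Longrightarrow> sum (wt (h i)) (F i) \<le> card (F i) * (1 - \<beta> / 2) ^ length (h i)"
    using step[of "card I * L + 1"] by blast
  obtain i where i: "i \<in> I" "L \<le> length (h i)"
    using exists_of_sum_ge[OF I(1), of L "\<lambda>i. length (h i)"] h(1) by auto
  define l where "l = length (h i)"
  have "nat \<lceil>4 * ln (card (F i)) / \<beta>\<rceil> \<le> (\<Sum>i\<in>I. nat \<lceil>4 * ln (card (F i)) / \<beta>\<rceil>)"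
    by (rule member_le_sum) (use i I in auto)
  then have "4 * ln (card (F i)) / \<beta> \<le> l" "0 < l"
    using i(2) unfolding l_def L_def by linarith+
  then have l: "ln (card (F i)) \<le> \<beta> * l / 4" using \<beta> by (simp add: field_simps)
  have cF: "0 < card (F i)" using F[OF i(1)] by (simp add: card_gt_0_iff)
  have "\<beta> / 4 * l \<le> cnt b (h i)" if b: "b \<in> F i" for b
  proof -
    have "wt (h i) b \<le> sum (wt (h i)) (F i)"
      using F[OF i(1)] b by (intro member_le_sum) (auto simp: wt_def)
    also have "\<dots> \<le> card (F i) * (1 - \<beta> / 2) ^ l" using h(3)[OF i(1)] by (simp add: l_def)
    also have "\<dots> \<le> card (F i) * exp (- \<beta> / 2) ^ l"
      using \<beta> exp_ge_add_one_self[of "- \<beta> / 2"] by (intro mult_left_mono power_mono) auto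
    also have "exp (- \<beta> / 2) ^ l = exp (- (\<beta> * l / 2))"
      by (simp add: mult.commute flip: exp_of_nat_mult)
    also have "card (F i) * \<dots> = exp (ln (card (F i)) + - (\<beta> * l / 2))"
      using cF by (simp only: exp_add) simp
    also have "\<dots> \<le> exp (- (\<beta> * l / 4))" using l by simp
    finally have "ln (wt (h i) b) \<le> ln (exp (- (\<beta> * l / 4)))"
      by (subst ln_le_cancel_iff) (auto simp: wt_def)
    then have "\<beta> * l / 4 \<le> cnt b (h i) * ln 2"
      by (simp add: wt_def ln_realpow ln_div)
    also have "\<dots> \<le> real (cnt b (h i)) * 1" using ln_2_less_1 by (intro mult_left_mono) auto
    finally show ?thesis by simp
  qed
  then show ?thesis
    using i h(2) \<open>0 < l\<close> unfolding l_def cnt_def by (intro bexI[of _ i] exI[of _ "h i"]) auto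
qed

section \<open>Subspaces meeting balls\<close>

text \<open>The family is indexed because points chosen in different balls may coincide;
  coefficients 1 and -1 on a repeated point then form a relation.\<close>

lemma linear_dependent_family:
  fixes f :: "'i \<Rightarrow> 'a::euclidean_space"
  assumes "finite A" "f ` A \<subseteq> V" "dim V < card A"
  shows "\<exists>c. (\<exists>i\<in>A. c i \<noteq> 0) \<and> (\<Sum>i\<in>A. c i *\<^sub>R f i) = 0"
proof (cases "inj_on f A")
  case True
  have "dim (f ` A) \<le> dim V" using assms(2) by (rule dim_subset)
  then have "dependent (f ` A)"
    using assms True by (intro dependent_biggerset_general) (simp add: card_image)
  then obtain u where "\<exists>v\<in>f ` A. u v \<noteq> 0" "(\<Sum>v\<in>f ` A. u v *\<^sub>R v) = 0"
    using assms(1) by (auto simp: dependent_finite)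
  with True show ?thesis
    by (intro exI[of _ "\<lambda>i. u (f i)"]) (simp add: sum.reindex)
next
  case False
  then obtain a b where ab: "a \<in> A" "b \<in> A" "a \<noteq> b" "f a = f b" by (auto simp: inj_on_def)
  define c where "c i = (if i = a then 1 else if i = b then -1 else 0 :: real)" for i
  have "(\<Sum>i\<in>A. c i *\<^sub>R f i) = (\<Sum>i\<in>{a, b}. c i *\<^sub>R f i)"
    using assms(1) ab by (intro sum.mono_neutral_right) (auto simp: c_def)
  also have "\<dots> = 0" using ab by (simp add: c_def)
  finally show ?thesis using ab by (intro exI[of _ c]) (auto simp: c_def)
qed

text \<open>The \<open>m\<close> grid points may be dependent, so their span has to be enlarged to
  dimension exactly \<open>m\<close>. A basis of it is extended to the whole space, and
  \<open>m\<close> vectors in between are kept.\<close>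

lemma exists_superspace_of_dim:
  fixes S :: "'a::euclidean_space set"
  assumes "finite S" "card S \<le> m" "m \<le> DIM('a)"
  shows "\<exists>V. subspace V \<and> dim V = m \<and> S \<subseteq> V"
proof -
  obtain B where B: "B \<subseteq> S" "independent B" "S \<subseteq> span B"
    by (metis maximal_independent_subset)
  obtain C where C: "B \<subseteq> C" "independent C" "UNIV \<subseteq> span C"
    using maximal_independent_subset_extend[of B UNIV] B(2) by auto
  have finC: "finite C" using C(2) by (rule independent_imp_finite)
  have "card C = DIM('a)"
    using C by (metis dim_UNIV dim_eq_card top.extremum_uniqueI span_UNIV)
  moreover have "card B \<le> m" using B(1) assms card_mono le_trans by blast
  ultimately obtain D where D: "B \<subseteq> D" "D \<subseteq> C" "card D = m"
    using exists_subset_between[of B m C] C(1) finC assms(3) by auto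
  have "independent D" using C(2) D(2) by (rule independent_mono)
  then have "dim (span D) = m" using D(3) by (simp add: dim_eq_card_independent)
  moreover have "S \<subseteq> span D" using B(3) span_mono[OF D(1)] by blast
  ultimately show ?thesis by (intro exI[of _ "span D"]) simp
qed

text \<open>Solving the linear relation for \<open>b j\<close> expresses it by the other
  \<open>m\<close> points, and with mesh \<open>1 / (2 * m)\<close> rounding these to scaled grid
  points costs at most half of \<open>r j\<close> in total. Radius 2 of the net leaves room for a
  unit displacement from the centre plus a shift of length at most 1.\<close>

lemma perturbed_centers_span_hits:
  fixes x :: "'i \<Rightarrow> 'a::euclidean_space" and r :: "'i \<Rightarrow> real"
  assumes I: "finite I" "card I = Suc m" and m: "0 < m"
    and V: "subspace V" "dim V = m" and r: "\<And>i. i \<in> I \<Longrightarrow> 0 \<le> r i"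
    and hit: "\<And>i. i \<in> I \<Longrightarrow> \<exists>v\<in>V. dist (x i) v \<le> r i"
    and N: "\<And>v. norm v \<le> 2 \<Longrightarrow> \<exists>n\<in>N. norm (n - v) \<le> 1 / (2 * real m)"
  shows "\<exists>j\<in>I. \<exists>n. (\<forall>i. n i \<in> N) \<and>
    (\<exists>y\<in>span ((\<lambda>i. x i + r i *\<^sub>R n i) ` (I - {j})). dist (x j) y \<le> r j)"
proof -
  define \<delta> where "\<delta> = 1 / (2 * real m)"
  have \<delta>: "0 < \<delta>" "\<delta> \<le> 1" "2 * \<delta> * m = 1" using m by (auto simp: \<delta>_def divide_simps)
  obtain b where b: "\<And>i. i \<in> I \<Longrightarrow> b i \<in> V \<and> dist (x i) (b i) \<le> r i" using hit by metis
  obtain c where c: "\<exists>i\<in>I. c i \<noteq> 0" "(\<Sum>i\<in>I. c i *\<^sub>R b i) = 0"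
    using linear_dependent_family[of I b V] b I V by auto
  \<comment> \<open>Zero coefficients are excluded because the maximum may be 0, and
    \<open>c j\<close> becomes a divisor.\<close>
  let ?Z = "{i \<in> I. c i \<noteq> 0}"
  have "finite ?Z" "?Z \<noteq> {}" using I c(1) by auto
  \<comment> \<open>Maximality makes the displacements of the other points, of size \<open>r i\<close>, move \<open>b j\<close> by only \<open>O(r j)\<close>.\<close>
  then obtain j where "j \<in> ?Z" "\<bar>c j\<bar> * r j = Max ((\<lambda>i. \<bar>c i\<bar> * r i) ` ?Z)"
    by (metis (no_types, lifting) obtains_MAX)
  then have j: "j \<in> I" "c j \<noteq> 0" "\<And>i. i \<in> I \<Longrightarrow> c i \<noteq> 0 \<Longrightarrow> \<bar>c i\<bar> * r i \<le> \<bar>c j\<bar> * r j"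
    using \<open>finite ?Z\<close> by auto
  define J where "J = I - {j}"
  have J: "finite J" "card J = m" using I j(1) by (auto simp: J_def)
  define a where "a i = - (c i / c j)" for i
  have bj: "b j = (\<Sum>i\<in>J. a i *\<^sub>R b i)"
  proof -
    have "c j *\<^sub>R b j = - (\<Sum>i\<in>J. c i *\<^sub>R b i)"
      using c(2) sum.remove[OF I(1) j(1), of "\<lambda>i. c i *\<^sub>R b i"]
      by (simp add: J_def eq_neg_iff_add_eq_0)
    then have "(1 / c j) *\<^sub>R c j *\<^sub>R b j = (1 / c j) *\<^sub>R - (\<Sum>i\<in>J. c i *\<^sub>R b i)" by simp
    then show ?thesis
      using j(2) by (simp add: a_def scaleR_sum_right sum_negf)
  qed
  have ar: "\<bar>a i\<bar> * r i \<le> r j" if "i \<in> J" for i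
  proof (cases "c i = 0")
    case True
    then show ?thesis using r[OF j(1)] by (simp add: a_def)
  next
    case False
    then have "\<bar>c i\<bar> * r i \<le> \<bar>c j\<bar> * r j" using that j(3) by (simp add: J_def)
    then show ?thesis using j(2) by (simp add: a_def abs_divide divide_simps mult.commute)
  qed
  define t where "t = (\<Sum>i\<in>J. \<bar>a i\<bar> * r i)"
  have t: "0 \<le> t" "t \<le> m * r j"
  proof -
    show "0 \<le> t" unfolding t_def using r by (intro sum_nonneg) (auto simp: J_def)
    show "t \<le> m * r j" unfolding t_def using sum_bounded_above[of J _ "r j", OF ar] J by simp
  qed
  define u where "u = sgn (x j - b j)"
  have nu: "norm u \<le> 1" by (simp add: u_def norm_sgn)
  \<comment> \<open>The sign aligns all displacements so that \<open>b j\<close> is pushed towards the centre \<open>x j\<close>; this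
    absorbs the rounding error even if \<open>b j\<close> is on the boundary. If \<open>r i = 0\<close> then \<open>v i\<close> is irrelevant.\<close>
  define v where "v i = (b i - x i) /\<^sub>R r i + (\<delta> * sgn (a i)) *\<^sub>R u" for i
  have "norm (v i) \<le> 2" if "i \<in> J" for i
  proof -
    have "norm (b i - x i) \<le> r i" "0 \<le> r i"
      using b[of i] r[of i] that by (auto simp: J_def dist_norm norm_minus_commute)
    then have "norm ((b i - x i) /\<^sub>R r i) \<le> 1" by (cases "r i = 0") (auto simp: divide_simps)
    moreover have "norm ((\<delta> * sgn (a i)) *\<^sub>R u) \<le> 1 * 1"
      unfolding norm_scaleR using \<delta> nu by (intro mult_mono) (auto simp: abs_mult sgn_if)
    ultimately show ?thesis unfolding v_def by (intro norm_triangle_le) simp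
  qed
  \<comment> \<open>Outside \<open>J\<close> any grid vector serves; the one near 0 makes
    \<open>n\<close> total with values in \<open>N\<close>.\<close>
  then have "\<exists>n\<in>N. i \<in> J \<longrightarrow> norm (n - v i) \<le> \<delta>" for i
    using N[of "v i"] N[of 0] unfolding \<delta>_def by (cases "i \<in> J") auto
  then obtain n where n: "\<And>i. n i \<in> N" "\<And>i. i \<in> J \<Longrightarrow> norm (n i - v i) \<le> \<delta>" by metis
  define g where "g i = x i + r i *\<^sub>R n i" for i
  define y where "y = (\<Sum>i\<in>J. a i *\<^sub>R g i)"
  have g: "g i = b i + (r i * \<delta> * sgn (a i)) *\<^sub>R u + r i *\<^sub>R (n i - v i)" if "i \<in> J" for i
  proof -
    have "x i + r i *\<^sub>R ((b i - x i) /\<^sub>R r i) = b i"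
      using b[of i] that by (cases "r i = 0") (auto simp: J_def)
    then show ?thesis by (simp add: g_def v_def algebra_simps)
  qed
  have "y = (\<Sum>i\<in>J. a i *\<^sub>R b i + (\<delta> * (\<bar>a i\<bar> * r i)) *\<^sub>R u + (a i * r i) *\<^sub>R (n i - v i))"
    unfolding y_def
  proof (rule sum.cong)
    fix i assume "i \<in> J"
    have "a i * (r i * \<delta> * sgn (a i)) = \<delta> * (\<bar>a i\<bar> * r i)" by (simp add: sgn_if)
    then show "a i *\<^sub>R g i = a i *\<^sub>R b i + (\<delta> * (\<bar>a i\<bar> * r i)) *\<^sub>R u + (a i * r i) *\<^sub>R (n i - v i)"
      unfolding g[OF \<open>i \<in> J\<close>] by (simp only: scaleR_add_right scaleR_scaleR)
  qed simp
  also have "\<dots> = b j + (\<delta> * t) *\<^sub>R u + (\<Sum>i\<in>J. (a i * r i) *\<^sub>R (n i - v i))"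
    by (simp add: sum.distrib bj t_def sum_distrib_left scaleR_sum_left)
  finally have y: "y = b j + (\<delta> * t) *\<^sub>R u + (\<Sum>i\<in>J. (a i * r i) *\<^sub>R (n i - v i))" .
  have err: "norm (\<Sum>i\<in>J. (a i * r i) *\<^sub>R (n i - v i)) \<le> \<delta> * t"
    unfolding t_def sum_distrib_left
  proof (rule sum_norm_le)
    fix i assume i: "i \<in> J"
    have "norm ((a i * r i) *\<^sub>R (n i - v i)) = (\<bar>a i\<bar> * r i) * norm (n i - v i)"
      using r[of i] i by (simp add: J_def abs_mult)
    also have "\<dots> \<le> (\<bar>a i\<bar> * r i) * \<delta>"
      using n(2)[OF i] r[of i] i by (intro mult_left_mono) (auto simp: J_def)
    finally show "norm ((a i * r i) *\<^sub>R (n i - v i)) \<le> \<delta> * (\<bar>a i\<bar> * r i)" by (simp add: mult.commute)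
  qed
  define l where "l = norm (x j - b j)"
  have l: "0 \<le> l" "l \<le> r j" using b[OF j(1)] by (auto simp: l_def dist_norm)
  have "x j - b j = l *\<^sub>R u" unfolding l_def u_def by (cases "x j = b j") (simp_all add: sgn_div_norm)
  then have "x j - y = (l - \<delta> * t) *\<^sub>R u - (\<Sum>i\<in>J. (a i * r i) *\<^sub>R (n i - v i))"
    unfolding y by (simp add: algebra_simps)
  then have "norm (x j - y) \<le> norm ((l - \<delta> * t) *\<^sub>R u) + norm (\<Sum>i\<in>J. (a i * r i) *\<^sub>R (n i - v i))"
    by (simp only: norm_triangle_ineq4)
  also have "\<dots> \<le> \<bar>l - \<delta> * t\<bar> * 1 + \<delta> * t"
    unfolding norm_scaleR using nu err by (intro add_mono mult_left_mono) auto
  \<comment> \<open>If \<open>\<delta> * t \<le> l\<close>, the shift cancels the error and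
    \<open>l\<close> remains. Otherwise the bound is \<open>2 * \<delta> * t - l\<close>, which
    \<open>t \<le> m * r j\<close> controls.\<close>
  also have "\<dots> \<le> r j"
  proof -
    have "2 * \<delta> * t \<le> 2 * \<delta> * (m * r j)" using t(2) \<delta> by (intro mult_left_mono) auto
    also have "\<dots> = r j" using \<delta>(3) by (simp add: mult.assoc[symmetric])
    finally show ?thesis using l by (auto simp: abs_if)
  qed
  finally have "dist (x j) y \<le> r j" by (simp add: dist_norm)
  moreover have "y \<in> span (g ` J)"
    unfolding y_def by (intro span_sum span_scale span_base) auto
  ultimately show ?thesis using n(1) j(1) unfolding g_def J_def by blast
qed

section \<open>VC dimension of subspaces meeting balls\<close>

definition meets_ball :: "'a::metric_space set \<Rightarrow> 'a \<times> real \<Rightarrow> bool" where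
  "meets_ball V b \<longleftrightarrow> (\<exists>v\<in>V. dist (fst b) v \<le> snd b)"

text \<open>
  \<open>Q\<close> is the orthogonal projection onto \<open>V\<close>. For a fixed ball the condition is affine in \<open>Q\<close>,
  which bounds the VC dimension of the sets of subspaces that meet a ball.
\<close>

lemma meets_ball_iff_projection:
  fixes V :: "(real ^ 'n) set"
  assumes "subspace V"
  shows "\<exists>Q :: real ^ 'n ^ 'n. \<forall>x r. 0 \<le> r \<longrightarrow>
    (meets_ball V (x, r) \<longleftrightarrow> (norm x)\<^sup>2 - Q \<bullet> (\<chi> i j. x $ i * x $ j) \<le> r\<^sup>2)"
proof -
  obtain B where B: "B \<subseteq> V" "pairwise orthogonal B" "\<And>e. e \<in> B \<Longrightarrow> norm e = 1"
    "independent B" "span B = V"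
    using orthonormal_basis_subspace[OF assms] by metis
  have fB: "finite B" using B(4) by (rule independent_imp_finite)
  \<comment> \<open>Its inner product with the outer product of \<open>x\<close> with itself is the
    squared length of the projection of \<open>x\<close>; Pythagoras then gives the squared distance
    to \<open>V\<close>.\<close>
  define Q :: "real ^ 'n ^ 'n" where "Q = (\<Sum>e\<in>B. \<chi> i j. e $ i * e $ j)"
  have "meets_ball V (x, r) \<longleftrightarrow> (norm x)\<^sup>2 - Q \<bullet> (\<chi> i j. x $ i * x $ j) \<le> r\<^sup>2" if r: "0 \<le> r" for x r
  proof -
    have outer: "(\<chi> i j. e $ i * e $ j) \<bullet> (\<chi> i j. x $ i * x $ j) = (e \<bullet> x)\<^sup>2" for e :: "real ^ 'n"
      by (simp add: inner_vec_def power2_eq_square sum_product sum_distrib_left ac_simps)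
    define z where "z = (\<Sum>e\<in>B. (e \<bullet> x) *\<^sub>R e)"
    have zV: "z \<in> V" unfolding z_def using B assms by (auto intro!: subspace_sum subspace_scale)
    have ez: "e \<bullet> z = e \<bullet> x" if "e \<in> B" for e
    proof -
      have "e \<bullet> z = (\<Sum>f\<in>B. if f = e then e \<bullet> x else 0)"
        unfolding z_def inner_sum_right using B(2,3) that
        by (intro sum.cong) (auto simp: pairwise_def orthogonal_def dot_square_norm)
      then show ?thesis using that fB by simp
    qed
    have orth: "(x - z) \<bullet> v = 0" if "v \<in> V" for v
    proof -
      have "orthogonal (x - z) v"
        using B(5) that ez inner_commute[of x] inner_commute[of z]
        by (intro orthogonal_to_span[of v B]) (auto simp: orthogonal_def inner_diff_left)
      then show ?thesis by (simp add: orthogonal_def)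
    qed
    have zz: "z \<bullet> z = Q \<bullet> (\<chi> i j. x $ i * x $ j)"
    proof -
      have "z \<bullet> z = (\<Sum>e\<in>B. (e \<bullet> x) * (e \<bullet> z))"
        by (simp add: z_def inner_sum_left)
      also have "\<dots> = (\<Sum>e\<in>B. (e \<bullet> x)\<^sup>2)" by (rule sum.cong) (auto simp: ez power2_eq_square)
      finally show ?thesis by (simp add: Q_def inner_sum_left outer)
    qed
    have xz: "(norm (x - z))\<^sup>2 = (norm x)\<^sup>2 - Q \<bullet> (\<chi> i j. x $ i * x $ j)"
      using orth[OF zV] zz by (simp add: power2_norm_eq_inner inner_diff_left inner_diff_right inner_commute)
    have min: "norm (x - z) \<le> dist x v" if "v \<in> V" for v
    proof -
      have "(x - z) \<bullet> (z - v) = 0" using orth zV that assms by (intro orth subspace_diff)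
      then have "(norm (x - z))\<^sup>2 \<le> (norm ((x - z) + (z - v)))\<^sup>2"
        by (simp only: norm_add_Pythagorean orthogonal_def) simp
      then have "norm (x - z) \<le> norm ((x - z) + (z - v))" by (rule power2_le_imp_le) simp
      then show ?thesis by (simp add: dist_norm)
    qed
    have "meets_ball V (x, r) \<longleftrightarrow> norm (x - z) \<le> r"
      using min zV unfolding meets_ball_def by (auto simp: dist_norm intro: order_trans)
    also have "\<dots> \<longleftrightarrow> (norm (x - z))\<^sup>2 \<le> r\<^sup>2" using r by (simp add: power_mono_iff)
    finally show ?thesis by (simp add: xz)
  qed
  then show ?thesis by blast
qed

text \<open>A Radon-type argument. Too many vectors \<open>(1, Q t)\<close> satisfy a linear
  relation \<open>c\<close>. The coordinate 1 makes the coefficients sum to zero, so the relation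
  annihilates every function affine in \<open>Q t\<close>. A ball meeting exactly the subspaces with
  \<open>c t \<ge> 0\<close> contradicts this. The shattered points are indices, so repeated
  subspaces are allowed.\<close>

lemma shattered_by_balls_card_le:
  fixes V :: "'i \<Rightarrow> (real ^ 'n) set"
  assumes V: "\<And>t. t \<in> T \<Longrightarrow> subspace (V t)" and F: "\<And>b. b \<in> F \<Longrightarrow> 0 \<le> snd b"
    and A: "finite A" "shatters ((\<lambda>b. {t \<in> T. meets_ball (V t) b}) ` F) A"
  shows "card A \<le> DIM(real \<times> (real ^ 'n ^ 'n))"
proof (rule ccontr)
  assume big: "\<not> ?thesis"
  have sh: "\<exists>b\<in>F. {t \<in> T. meets_ball (V t) b} \<inter> A = S" if "S \<subseteq> A" for S
    using A(2) that unfolding shatters_def by blast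
  have AT: "A \<subseteq> T" using sh[of A] by auto
  obtain Q :: "'i \<Rightarrow> real ^ 'n ^ 'n" where Q: "\<And>t x r. t \<in> T \<Longrightarrow> 0 \<le> r \<Longrightarrow>
      meets_ball (V t) (x, r) \<longleftrightarrow> (norm x)\<^sup>2 - Q t \<bullet> (\<chi> i j. x $ i * x $ j) \<le> r\<^sup>2"
    using meets_ball_iff_projection[OF V] by metis
  have "dim (UNIV :: (real \<times> (real ^ 'n ^ 'n)) set) < card A" using big by (simp only: dim_UNIV not_le)
  from linear_dependent_family[OF A(1) subset_UNIV this, of "\<lambda>t. (1, Q t)"]
  obtain c where c: "\<exists>t\<in>A. c t \<noteq> 0" "(\<Sum>t\<in>A. c t *\<^sub>R (1 :: real, Q t)) = 0" by blast
  have c1: "(\<Sum>t\<in>A. c t) = 0" and c2: "(\<Sum>t\<in>A. c t *\<^sub>R Q t) = 0"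
    using c(2) by (simp_all add: prod_eq_iff fst_sum snd_sum)
  define g where "g b t = (snd b)\<^sup>2 - (norm (fst b))\<^sup>2 + Q t \<bullet> (\<chi> i j. fst b $ i * fst b $ j)" for b t
  have hit: "meets_ball (V t) b \<longleftrightarrow> 0 \<le> g b t" if "b \<in> F" "t \<in> A" for b t
    using Q[of t "snd b" "fst b"] F[OF that(1)] AT that(2) by (auto simp: g_def)
  have zero: "(\<Sum>t\<in>A. c t * g b t) = 0" for b
  proof -
    have "(\<Sum>t\<in>A. c t * g b t) = (\<Sum>t\<in>A. c t) * ((snd b)\<^sup>2 - (norm (fst b))\<^sup>2)
        + (\<Sum>t\<in>A. c t *\<^sub>R Q t) \<bullet> (\<chi> i j. fst b $ i * fst b $ j)"
      by (simp add: g_def distrib_left sum.distrib sum_distrib_right inner_sum_left)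
    then show ?thesis by (simp add: c1 c2)
  qed
  have "\<exists>t\<in>A. c t < 0"
  proof (rule ccontr)
    assume "\<not> ?thesis"
    then have "\<forall>t\<in>A. c t = 0"
      using c1 A(1) by (subst (asm) sum_nonneg_eq_0_iff) auto
    with c(1) show False by blast
  qed
  then obtain t0 where t0: "t0 \<in> A" "c t0 < 0" by blast
  obtain b where b: "b \<in> F" "{t \<in> T. meets_ball (V t) b} \<inter> A = {t \<in> A. 0 \<le> c t}"
    using sh[of "{t \<in> A. 0 \<le> c t}"] by auto
  have sgn: "0 \<le> g b t \<longleftrightarrow> 0 \<le> c t" if "t \<in> A" for t
    using hit[OF b(1) that] b(2) AT that by blast
  have nn: "0 \<le> c t * g b t" if "t \<in> A" for t
    using sgn[OF that] by (auto simp: zero_le_mult_iff)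
  \<comment> \<open>Strictness comes from a negative coefficient: missing the ball means
    \<open>g b t0 < 0\<close>, whereas \<open>g b t\<close> may vanish when the ball is met.\<close>
  have "0 < c t0 * g b t0" using sgn[OF t0(1)] t0(2) by (auto intro: mult_neg_neg)
  then have "0 < (\<Sum>t\<in>A. c t * g b t)" using nn t0(1) A(1) by (intro sum_pos2[of A t0]) auto
  with zero show False by simp
qed

section \<open>Colorful transversals\<close>

text \<open>The constant is an epsilon net size. The grid, the bound \<open>M\<close> on the number
  of candidates and the fraction \<open>\<beta>\<close> behind it are all fixed before the families
  are introduced.\<close>

theorem colorful_ball_transversals:
  fixes m p :: nat
  assumes m: "0 < m" "m \<le> CARD('n::finite)" and p: "0 < p"
  shows "\<exists>C::nat. \<forall>F :: nat \<Rightarrow> ((real ^ 'n) \<times> real) set.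
    (\<forall>i\<in>{1..p}. finite (F i) \<and> (\<forall>b\<in>F i. 0 \<le> snd b)) \<longrightarrow>
    (\<forall>B. (\<forall>i\<in>{1..p}. B i \<in> F i) \<longrightarrow>
       (\<exists>I\<subseteq>{1..p}. card I = Suc m \<and> (\<exists>V. subspace V \<and> dim V = m \<and> (\<forall>i\<in>I. meets_ball V (B i))))) \<longrightarrow>
    (\<exists>i\<in>{1..p}. \<exists>G\<subseteq>{V. subspace V \<and> dim V = m}. finite G \<and> card G \<le> C \<and>
       (\<forall>b\<in>F i. \<exists>V\<in>G. meets_ball V b))"
proof -
  let ?P = "{V :: (real ^ 'n) set. subspace V \<and> dim V = m}"
  have "compact (cball (0 :: real ^ 'n) 2)" by simp
  then obtain N where N: "finite N" "cball (0 :: real ^ 'n) 2 \<subseteq> (\<Union>x\<in>N. ball x (1 / (2 * real m)))"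
    unfolding compact_eq_totally_bounded using m by (metis half_gt_zero_iff divide_pos_pos mult_pos_pos of_nat_0_less_iff zero_less_numeral zero_less_one)
  have net: "\<exists>n\<in>N. norm (n - v) \<le> 1 / (2 * real m)" if "norm v \<le> 2" for v
  proof -
    have "v \<in> cball 0 2" using that by simp
    then obtain n where "n \<in> N" "dist n v < 1 / (2 * real m)" using N(2) by auto
    then show ?thesis by (intro bexI[of _ n]) (auto simp: dist_norm)
  qed
  \<comment> \<open>A fixed choice, so that a candidate subspace is determined by the points it has
    to contain.\<close>
  define W where "W S = (SOME V. V \<in> ?P \<and> S \<subseteq> V)" for S :: "(real ^ 'n) set"
  have W: "W S \<in> ?P \<and> S \<subseteq> W S" if "finite S" "card S \<le> m" for S
    unfolding W_def by (rule someI_ex) (use exists_superspace_of_dim[OF that] m in auto)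
  \<comment> \<open>\<open>J\<close> avoids \<open>j\<close>, so the candidates for \<open>j\<close>
    do not depend on \<open>B j\<close>, as the random tuple argument demands.\<close>
  define \<G> where "\<G> j B = (\<lambda>(J, n). W ((\<lambda>i. fst (B i) + snd (B i) *\<^sub>R n i) ` J)) `
      ({J. J \<subseteq> {1..p} - {j} \<and> card J = m} \<times> ({1..p} \<rightarrow>\<^sub>E N))"
    for j and B :: "nat \<Rightarrow> (real ^ 'n) \<times> real"
  \<comment> \<open>Contains the parameters of the candidates for every \<open>j\<close> and
    \<open>B\<close>, which yields one common bound \<open>M\<close>.\<close>
  define D where "D = {J. J \<subseteq> {1..p}} \<times> ({1..p} \<rightarrow>\<^sub>E N)"
  define M where "M = card D"
  have fD: "finite D" unfolding D_def using N by (intro finite_cartesian_product finite_PiE) auto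
  have \<G>: "finite (\<G> j B) \<and> card (\<G> j B) \<le> M" for j B
  proof -
    let ?E = "{J. J \<subseteq> {1..p} - {j} \<and> card J = m} \<times> ({1..p} \<rightarrow>\<^sub>E N)"
    have E: "?E \<subseteq> D" by (auto simp: D_def)
    then have "finite ?E" using fD by (rule finite_subset)
    then have "card (\<G> j B) \<le> card ?E" "finite (\<G> j B)"
      unfolding \<G>_def by (auto intro: card_image_le)
    then show ?thesis using card_mono[OF fD E] by (simp add: M_def)
  qed
  have \<G>upd: "\<G> j (B(j := b)) = \<G> j B" for j B b
    unfolding \<G>_def
  proof (rule image_cong[OF refl], clarify)
    fix J n assume "J \<subseteq> {1..p} - {j}"
    then have "(\<lambda>i. fst ((B(j := b)) i) + snd ((B(j := b)) i) *\<^sub>R n i) ` J = (\<lambda>i. fst (B i) + snd (B i) *\<^sub>R n i) ` J"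
      by (intro image_cong) auto
    then show "W ((\<lambda>i. fst ((B(j := b)) i) + snd ((B(j := b)) i) *\<^sub>R n i) ` J)
      = W ((\<lambda>i. fst (B i) + snd (B i) *\<^sub>R n i) ` J)" by simp
  qed
  have \<G>P: "\<G> j B \<subseteq> ?P" for j B
  proof
    fix V assume "V \<in> \<G> j B"
    then obtain J n where J: "J \<subseteq> {1..p} - {j}" "card J = m"
      and V: "V = W ((\<lambda>i. fst (B i) + snd (B i) *\<^sub>R n i) ` J)" unfolding \<G>_def by auto
    have "finite J" using J(1) finite_subset by blast
    then show "V \<in> ?P" unfolding V using W J(2) card_image_le by blast
  qed
  define q where "q = real (p * M + 1)"
  have "real 1 \<le> q" unfolding q_def by (intro of_nat_mono) simp
  then have q: "1 \<le> q" by (simp only: of_nat_1)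
  define \<beta> where "\<beta> = 1 / q"
  have \<beta>: "0 < \<beta>" "\<beta> \<le> 1" unfolding \<beta>_def using q by simp_all
  have "0 < \<beta> / 4" using \<beta> by simp
  from epsilon_net[OF this, where 'a = nat and D = "DIM(real \<times> (real ^ 'n ^ 'n))"]
  obtain s where s: "\<forall>(X :: nat set) \<R>. finite X \<longrightarrow> X \<noteq> {} \<longrightarrow>
    (\<forall>R\<in>\<R>. R \<subseteq> X \<and> \<beta> / 4 * card X \<le> card R) \<longrightarrow>
    (\<forall>A. finite A \<longrightarrow> shatters \<R> A \<longrightarrow> card A \<le> DIM(real \<times> (real ^ 'n ^ 'n))) \<longrightarrow>
    (\<exists>N\<subseteq>X. card N \<le> s \<and> (\<forall>R\<in>\<R>. R \<inter> N \<noteq> {}))"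
    by (rule exE)
  show ?thesis
  proof (intro exI[of _ s] allI impI)
    fix F :: "nat \<Rightarrow> ((real ^ 'n) \<times> real) set"
    assume F: "\<forall>i\<in>{1..p}. finite (F i) \<and> (\<forall>b\<in>F i. 0 \<le> snd b)"
      and hyp: "\<forall>B. (\<forall>i\<in>{1..p}. B i \<in> F i) \<longrightarrow>
       (\<exists>I\<subseteq>{1..p}. card I = Suc m \<and> (\<exists>V. subspace V \<and> dim V = m \<and> (\<forall>i\<in>I. meets_ball V (B i))))"
    show "\<exists>i\<in>{1..p}. \<exists>G\<subseteq>?P. finite G \<and> card G \<le> s \<and> (\<forall>b\<in>F i. \<exists>V\<in>G. meets_ball V b)"
    proof (cases "\<exists>i\<in>{1..p}. F i = {}")
      case True
      then obtain i where "i \<in> {1..p}" "F i = {}" by blast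
      then show ?thesis by (intro bexI[of _ i] exI[of _ "{}"]) auto
    next
      case False
      then have fF: "finite (F i) \<and> F i \<noteq> {}" if "i \<in> {1..p}" for i using F that by blast
      have canon: "\<exists>j\<in>{1..p}. \<exists>V\<in>\<G> j B. meets_ball V (B j)" if B: "B \<in> Pi\<^sub>E {1..p} F" for B
      proof -
        obtain I V where I: "I \<subseteq> {1..p}" "card I = Suc m"
          and V: "subspace V" "dim V = m" "\<And>i. i \<in> I \<Longrightarrow> meets_ball V (B i)"
          using hyp B by (metis PiE_mem)
        have "\<exists>j\<in>I. \<exists>n. (\<forall>i. n i \<in> N) \<and>
          (\<exists>y\<in>span ((\<lambda>i. fst (B i) + snd (B i) *\<^sub>R n i) ` (I - {j})). dist (fst (B j)) y \<le> snd (B j))"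
        proof (rule perturbed_centers_span_hits[OF _ I(2) m(1) V(1,2) _ _ net])
          show "finite I" using I(1) finite_subset by blast
          show "0 \<le> snd (B i)" if "i \<in> I" for i using that I(1) F B PiE_mem by blast
          show "\<exists>v\<in>V. dist (fst (B i)) v \<le> snd (B i)" if "i \<in> I" for i
            using V(3)[OF that] by (simp add: meets_ball_def)
        qed
        then obtain j n y where j: "j \<in> I" and n: "\<And>i. n i \<in> N"
          and y: "y \<in> span ((\<lambda>i. fst (B i) + snd (B i) *\<^sub>R n i) ` (I - {j}))" "dist (fst (B j)) y \<le> snd (B j)"
          by blast
        \<comment> \<open>Restricting \<open>n\<close> puts it into the finite parameter set of
          \<open>\<G>\<close> and keeps its values on \<open>I\<close>.\<close>
        let ?J = "I - {j}" and ?n = "restrict n {1..p}"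
        let ?S = "(\<lambda>i. fst (B i) + snd (B i) *\<^sub>R ?n i) ` ?J"
        have J: "?J \<subseteq> {1..p} - {j}" "finite ?J" "card ?J = m"
          using I j finite_subset[OF I(1)] by (auto simp: card_Diff_singleton)
        have S: "?S = (\<lambda>i. fst (B i) + snd (B i) *\<^sub>R n i) ` ?J"
          using I(1) by (intro image_cong) auto
        have "W ?S \<in> ?P \<and> ?S \<subseteq> W ?S" using J card_image_le[OF J(2)] by (intro W) auto
        then have "span ?S \<subseteq> W ?S" by (intro span_minimal) auto
        then have "meets_ball (W ?S) (B j)" using y unfolding S meets_ball_def by blast
        moreover have "W ?S \<in> \<G> j B"
          unfolding \<G>_def using J n by (intro image_eqI[of _ _ "(?J, ?n)"]) auto
        ultimately show ?thesis using j I(1) by blast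
      qed
      have frac: "\<exists>i\<in>{1..p}. \<exists>V\<in>?P. \<beta> * sum (w i) (F i) \<le> sum (w i) {b \<in> F i. meets_ball V b}"
        if w: "\<And>i b. 0 < w i b" for w :: "nat \<Rightarrow> (real ^ 'n) \<times> real \<Rightarrow> real"
      proof -
        have "\<exists>i\<in>{1..p}. \<exists>B. \<exists>V\<in>\<G> i B.
            sum (w i) (F i) \<le> (card {1..p} * M + 1) * sum (w i) {b \<in> F i. meets_ball V b}"
        proof (rule colorful_fractional)
          show "finite {1..p}" by simp
          show "\<And>i. i \<in> {1..p} \<Longrightarrow> finite (F i) \<and> F i \<noteq> {}" by (rule fF)
          show "\<And>i b. 0 < w i b" by (rule w)
          show "\<And>j B b. \<G> j (B(j := b)) = \<G> j B" by (rule \<G>upd)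
          show "\<And>j B. j \<in> {1..p} \<Longrightarrow> finite (\<G> j B) \<and> card (\<G> j B) \<le> M" by (rule \<G>)
          show "\<And>B. B \<in> Pi\<^sub>E {1..p} F \<Longrightarrow> \<exists>j\<in>{1..p}. \<exists>V\<in>\<G> j B. meets_ball V (B j)" by (rule canon)
        qed
        then obtain i B V where i: "i \<in> {1..p}" "V \<in> \<G> i B"
          "sum (w i) (F i) \<le> (card {1..p} * M + 1) * sum (w i) {b \<in> F i. meets_ball V b}"
          by blast
        have "sum (w i) (F i) \<le> q * sum (w i) {b \<in> F i. meets_ball V b}"
          using i(3) unfolding q_def by (simp only: card_atLeastAtMost diff_Suc_1)
        then have "\<beta> * sum (w i) (F i) \<le> sum (w i) {b \<in> F i. meets_ball V b}"
          using q by (simp add: \<beta>_def pos_divide_le_eq mult.commute)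
        then show ?thesis using i(1,2) \<G>P by blast
      qed
      have "\<exists>i\<in>{1..p}. \<exists>xs. xs \<noteq> [] \<and> set xs \<subseteq> ?P \<and>
          (\<forall>b\<in>F i. \<beta> / 4 * length xs \<le> length (filter (\<lambda>V. meets_ball V b) xs))"
      proof (rule multiplicative_weights[OF _ _ _ \<beta>])
        show "finite {1..p}" "{1..p} \<noteq> {}" using p by simp_all
        show "\<And>i. i \<in> {1..p} \<Longrightarrow> finite (F i) \<and> F i \<noteq> {}" by (rule fF)
        show "\<And>w :: nat \<Rightarrow> (real ^ 'n) \<times> real \<Rightarrow> real. (\<And>i b. 0 < w i b) \<Longrightarrow>
          \<exists>i\<in>{1..p}. \<exists>V\<in>?P. \<beta> * sum (w i) (F i) \<le> sum (w i) {b \<in> F i. meets_ball V b}"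
          by (rule frac)
      qed
      then obtain i xs where i: "i \<in> {1..p}" and xs: "xs \<noteq> []" "set xs \<subseteq> ?P"
        and many: "\<And>b. b \<in> F i \<Longrightarrow> \<beta> / 4 * length xs \<le> length (filter (\<lambda>V. meets_ball V b) xs)"
        by blast
      \<comment> \<open>The ground set consists of positions in \<open>xs\<close>, so that a
        repeated subspace counts with multiplicity.\<close>
      let ?X = "{..<length xs}"
      let ?R = "\<lambda>b. {t \<in> ?X. meets_ball (xs ! t) b}"
      have "\<exists>T\<subseteq>?X. card T \<le> s \<and> (\<forall>R\<in>?R ` F i. R \<inter> T \<noteq> {})"
      proof (rule s[THEN spec[of _ ?X], THEN spec[of _ "?R ` F i"], THEN mp, THEN mp, THEN mp, THEN mp])
        show "?X \<noteq> {}" using xs by auto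
        show "\<forall>R\<in>?R ` F i. R \<subseteq> ?X \<and> \<beta> / 4 * card ?X \<le> card R"
          using many by (auto simp: length_filter_conv_card lessThan_def)
        show "\<forall>A. finite A \<longrightarrow> shatters (?R ` F i) A \<longrightarrow> card A \<le> DIM(real \<times> (real ^ 'n ^ 'n))"
        proof (intro allI impI)
          fix A assume A: "finite A" "shatters (?R ` F i) A"
          have "subspace (xs ! t)" if "t \<in> ?X" for t using that xs(2) nth_mem by blast
          then show "card A \<le> DIM(real \<times> (real ^ 'n ^ 'n))"
            using F i by (intro shattered_by_balls_card_le[OF _ _ A]) auto
        qed
      qed simp
      then obtain T where T: "T \<subseteq> ?X" "card T \<le> s" "\<And>b. b \<in> F i \<Longrightarrow> ?R b \<inter> T \<noteq> {}" by auto
      have fT: "finite T" using T(1) finite_subset by blast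
      let ?G = "(!) xs ` T"
      have "?G \<subseteq> ?P" using T(1) xs(2) nth_mem by blast
      moreover have "card ?G \<le> s" using card_image_le[OF fT, of "(!) xs"] T(2) by simp
      moreover have "\<exists>V\<in>?G. meets_ball V b" if "b \<in> F i" for b using T(3)[OF that] by blast
      ultimately show ?thesis using i fT by (intro bexI[of _ i] exI[of _ ?G]) auto
    qed
  qed
qed

section \<open>Translation between caps and balls\<close>

text \<open>
  Radii above \<open>pi / 2\<close> are truncated: such a cap contains a hemisphere and is hit by every great
  sphere, and the corresponding ball of radius 1 contains the origin.
\<close>

lemma hits_cap_iff_meets_ball:
  fixes x :: "real ^ 'n"
  assumes x: "norm x = 1" and \<epsilon>: "0 \<le> \<epsilon>" and V: "subspace V" "0 < dim V"
  shows "hits (sphere 0 1 \<inter> V) (cap x \<epsilon>) \<longleftrightarrow> meets_ball V (x, sin (min \<epsilon> (pi / 2)))"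
proof -
  have inV: "\<bar>x \<bullet> y\<bar> \<le> 1" if "norm y = 1" for y
    using Cauchy_Schwarz_ineq2[of x y] x that by simp
  have hits: "hits (sphere 0 1 \<inter> V) (cap x \<epsilon>) \<longleftrightarrow> (\<exists>y\<in>V. norm y = 1 \<and> arccos (x \<bullet> y) \<le> \<epsilon>)"
    by (auto simp: hits_def cap_def sphere_angle_def)
  show ?thesis
  proof (cases "pi / 2 \<le> \<epsilon>")
    case True
    obtain z where z: "z \<in> V" "z \<noteq> 0" using V(2) by (metis dim_eq_0 less_numeral_extra(3) subsetI singletonI)
    \<comment> \<open>One of the two unit vectors on the line of \<open>z\<close> lies in the closed
      hemisphere around \<open>x\<close>.\<close>
    define y where "y = (if 0 \<le> x \<bullet> z then 1 else - 1) *\<^sub>R (z /\<^sub>R norm z)"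
    have y: "y \<in> V" "norm y = 1" "0 \<le> x \<bullet> y"
      using z V(1) by (auto simp: y_def subspace_scale subspace_neg divide_simps)
    have "arccos (x \<bullet> y) \<le> pi / 2"
      using y inV[of y] arccos_le_pi2[of "x \<bullet> y"] by auto
    then have "hits (sphere 0 1 \<inter> V) (cap x \<epsilon>)" unfolding hits using y True by (intro bexI[of _ y]) auto
    moreover have "meets_ball V (x, sin (min \<epsilon> (pi / 2)))"
      using x subspace_0[OF V(1)] by (auto simp: meets_ball_def min_absorb2[OF True] intro!: bexI[of _ 0])
    ultimately show ?thesis by simp
  next
    case False
    then have \<epsilon>2: "\<epsilon> < pi / 2" by simp
    have cos: "0 < cos \<epsilon>" using \<epsilon> \<epsilon>2 by (intro cos_gt_zero_pi) auto
    have sin: "0 \<le> sin \<epsilon>" using \<epsilon> \<epsilon>2 by (intro sin_ge_zero) auto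
    have arc: "arccos (x \<bullet> y) \<le> \<epsilon> \<longleftrightarrow> cos \<epsilon> \<le> x \<bullet> y" if "norm y = 1" for y
    proof -
      have "arccos (x \<bullet> y) \<le> arccos (cos \<epsilon>) \<longleftrightarrow> cos \<epsilon> \<le> x \<bullet> y"
        using inV[OF that] by (intro arccos_le_mono) auto
      then show ?thesis using \<epsilon> \<epsilon>2 by (simp add: arccos_cos)
    qed
    have "(\<exists>y\<in>V. norm y = 1 \<and> cos \<epsilon> \<le> x \<bullet> y) \<longleftrightarrow> (\<exists>v\<in>V. dist x v \<le> sin \<epsilon>)"
    proof
      assume "\<exists>y\<in>V. norm y = 1 \<and> cos \<epsilon> \<le> x \<bullet> y"
      then obtain y where y: "y \<in> V" "norm y = 1" "cos \<epsilon> \<le> x \<bullet> y" by blast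
      \<comment> \<open>The projection of \<open>x\<close> onto the line of \<open>y\<close> is the
        required point of \<open>V\<close>.\<close>
      have "(norm (x - (x \<bullet> y) *\<^sub>R y))\<^sup>2 = 1 - (x \<bullet> y)\<^sup>2"
        using x y(2) unfolding power2_norm_eq_inner norm_eq_1
        by (simp add: inner_diff_left inner_diff_right inner_commute power2_eq_square)
      also have "\<dots> \<le> 1 - (cos \<epsilon>)\<^sup>2" using y(3) cos by (simp add: power_mono)
      also have "\<dots> = (sin \<epsilon>)\<^sup>2" by (simp add: sin_squared_eq)
      finally have "norm (x - (x \<bullet> y) *\<^sub>R y) \<le> sin \<epsilon>" using sin by (rule power2_le_imp_le)
      then show "\<exists>v\<in>V. dist x v \<le> sin \<epsilon>"
        using y(1) V(1) by (intro bexI[of _ "(x \<bullet> y) *\<^sub>R y"]) (auto simp: dist_norm subspace_scale)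
    next
      assume "\<exists>v\<in>V. dist x v \<le> sin \<epsilon>"
      then obtain v where v: "v \<in> V" "norm (x - v) \<le> sin \<epsilon>" by (auto simp: dist_norm)
      have "(norm (x - v))\<^sup>2 \<le> (sin \<epsilon>)\<^sup>2" using v(2) by (intro power_mono) auto
      also have "(norm (x - v))\<^sup>2 = 1 - 2 * (x \<bullet> v) + (norm v)\<^sup>2"
        using x unfolding power2_norm_eq_inner norm_eq_1
        by (simp add: inner_diff_left inner_diff_right inner_commute)
      finally have sq: "(norm v)\<^sup>2 + (cos \<epsilon>)\<^sup>2 \<le> 2 * (x \<bullet> v)" by (simp add: sin_squared_eq)
      \<comment> \<open>The inequality of arithmetic and geometric means turns the quadratic bound
        \<open>sq\<close> into one on the angle between \<open>x\<close> and
        \<open>v\<close>.\<close>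
      have "2 * norm v * cos \<epsilon> \<le> (norm v)\<^sup>2 + (cos \<epsilon>)\<^sup>2" by (rule sum_squares_bound)
      also note sq
      finally have *: "cos \<epsilon> * norm v \<le> x \<bullet> v" by (simp add: mult.commute)
      \<comment> \<open>Positivity of \<open>cos \<epsilon>\<close>, which holds below
        \<open>pi / 2\<close>, rules out \<open>v = 0\<close>, so \<open>v\<close> can be
        normalized.\<close>
      have "0 < (cos \<epsilon>)\<^sup>2" "0 \<le> (norm v)\<^sup>2" using cos by simp_all
      with sq have "0 < x \<bullet> v" by linarith
      then have "v \<noteq> 0" by auto
      then show "\<exists>y\<in>V. norm y = 1 \<and> cos \<epsilon> \<le> x \<bullet> y"
        using * v(1) V(1) by (intro bexI[of _ "v /\<^sub>R norm v"]) (auto simp: subspace_scale divide_simps)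
    qed
    then show ?thesis
      unfolding hits meets_ball_def using arc \<epsilon>2 by (auto simp: min_def)
  qed
qed

theorem theorem4p2:
  fixes d k p :: nat
  assumes "CARD('n::finite) = d + 1" and "0 < d" and "0 < k" and "k < d" and "k + 2 \<le> p"
  shows "\<exists>C::nat. \<forall>F :: nat \<Rightarrow> (real ^ 'n) set set.
    (\<forall>i\<in>{1..p}. finite (F i) \<and> F i \<subseteq> closed_caps) \<longrightarrow>
    (\<forall>B. (\<forall>i\<in>{1..p}. B i \<in> F i) \<longrightarrow>
       (\<exists>I\<subseteq>{1..p}. card I = k + 2 \<and> (\<exists>S\<in>great_spheres k. \<forall>i\<in>I. hits S (B i)))) \<longrightarrow>
    (\<exists>i\<in>{1..p}. \<exists>G\<subseteq>great_spheres k. finite G \<and> card G \<le> C \<and>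
       (\<forall>B\<in>F i. \<exists>S\<in>G. hits S B))"
proof -
  \<comment> \<open>One ball has to represent the cap for all subspaces simultaneously, so that
    \<open>\<phi>\<close> can be a function of the cap alone.\<close>
  have "\<exists>b. 0 \<le> snd b \<and> (\<forall>V. subspace V \<longrightarrow> 0 < dim V \<longrightarrow> (hits (sphere 0 1 \<inter> V) K \<longleftrightarrow> meets_ball V b))"
    if K: "K \<in> closed_caps" for K :: "(real ^ 'n) set"
  proof -
    obtain x \<epsilon> where "K = cap x \<epsilon>" "norm x = 1" "0 \<le> \<epsilon>" using K by (auto simp: closed_caps_def)
    moreover from this have "0 \<le> sin (min \<epsilon> (pi / 2))"
      using pi_gt_zero by (intro sin_ge_zero) linarith+
    ultimately show ?thesis
      using hits_cap_iff_meets_ball[of x \<epsilon>]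
      by (intro exI[of _ "(x, sin (min \<epsilon> (pi / 2)))"]) simp
  qed
  then obtain \<phi> :: "(real ^ 'n) set \<Rightarrow> (real ^ 'n) \<times> real" where \<phi>: "\<And>K. K \<in> closed_caps \<Longrightarrow> 0 \<le> snd (\<phi> K)"
    "\<And>K V. K \<in> closed_caps \<Longrightarrow> subspace V \<Longrightarrow> 0 < dim V \<Longrightarrow> hits (sphere 0 1 \<inter> V) K \<longleftrightarrow> meets_ball V (\<phi> K)"
    by metis
  obtain C :: nat where C: "\<And>F :: nat \<Rightarrow> ((real ^ 'n) \<times> real) set.
    (\<forall>i\<in>{1..p}. finite (F i) \<and> (\<forall>b\<in>F i. 0 \<le> snd b)) \<Longrightarrow>
    (\<forall>B. (\<forall>i\<in>{1..p}. B i \<in> F i) \<longrightarrow>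
       (\<exists>I\<subseteq>{1..p}. card I = Suc (k + 1) \<and> (\<exists>V. subspace V \<and> dim V = k + 1 \<and> (\<forall>i\<in>I. meets_ball V (B i))))) \<Longrightarrow>
    (\<exists>i\<in>{1..p}. \<exists>G\<subseteq>{V. subspace V \<and> dim V = k + 1}. finite G \<and> card G \<le> C \<and>
       (\<forall>b\<in>F i. \<exists>V\<in>G. meets_ball V b))"
    using colorful_ball_transversals[of "k + 1" p, where 'n = 'n] assms by auto
  show ?thesis
  proof (intro exI[of _ C] allI impI)
    fix F :: "nat \<Rightarrow> (real ^ 'n) set set"
    assume F: "\<forall>i\<in>{1..p}. finite (F i) \<and> F i \<subseteq> closed_caps"
      and hyp: "\<forall>B. (\<forall>i\<in>{1..p}. B i \<in> F i) \<longrightarrow>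
       (\<exists>I\<subseteq>{1..p}. card I = k + 2 \<and> (\<exists>S\<in>great_spheres k. \<forall>i\<in>I. hits S (B i)))"
    have "\<exists>i\<in>{1..p}. \<exists>G\<subseteq>{V. subspace V \<and> dim V = k + 1}. finite G \<and> card G \<le> C \<and>
       (\<forall>b\<in>\<phi> ` F i. \<exists>V\<in>G. meets_ball V b)"
    proof (rule C[of "\<lambda>i. \<phi> ` F i"])
      show "\<forall>i\<in>{1..p}. finite (\<phi> ` F i) \<and> (\<forall>b\<in>\<phi> ` F i. 0 \<le> snd b)" using F \<phi>(1) by blast
      show "\<forall>B. (\<forall>i\<in>{1..p}. B i \<in> \<phi> ` F i) \<longrightarrow> (\<exists>I\<subseteq>{1..p}. card I = Suc (k + 1) \<and>
          (\<exists>V. subspace V \<and> dim V = k + 1 \<and> (\<forall>i\<in>I. meets_ball V (B i))))"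
      proof (intro allI impI)
        fix B assume "\<forall>i\<in>{1..p}. B i \<in> \<phi> ` F i"
        \<comment> \<open>\<open>\<phi>\<close> need not be injective, so a cap is chosen for every
          ball of the tuple.\<close>
        then have "\<forall>i\<in>{1..p}. \<exists>K. K \<in> F i \<and> B i = \<phi> K" by blast
        from bchoice[OF this]
        obtain K where K: "\<And>i. i \<in> {1..p} \<Longrightarrow> K i \<in> F i \<and> B i = \<phi> (K i)" by blast
        then obtain I S where I: "I \<subseteq> {1..p}" "card I = k + 2" and S: "S \<in> great_spheres k"
          "\<And>i. i \<in> I \<Longrightarrow> hits S (K i)" using hyp[rule_format, of K] by blast
        obtain V where V: "S = sphere 0 1 \<inter> V" "subspace V" "dim V = k + 1"
          using S(1) by (auto simp: great_spheres_def)
        have "meets_ball V (B i)" if "i \<in> I" for i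
        proof -
          have i: "i \<in> {1..p}" using that I(1) by blast
          then have "K i \<in> closed_caps" using K F by blast
          then show ?thesis using \<phi>(2)[of "K i" V] S(2)[OF that] V K[OF i] by simp
        qed
        then show "\<exists>I\<subseteq>{1..p}. card I = Suc (k + 1) \<and>
            (\<exists>V. subspace V \<and> dim V = k + 1 \<and> (\<forall>i\<in>I. meets_ball V (B i)))"
          using I V by (intro exI[of _ I] conjI exI[of _ V]) auto
      qed
    qed
    then obtain i G where i: "i \<in> {1..p}" and G: "G \<subseteq> {V. subspace V \<and> dim V = k + 1}" "finite G"
      "card G \<le> C" "\<And>K. K \<in> F i \<Longrightarrow> \<exists>V\<in>G. meets_ball V (\<phi> K)" by auto
    let ?H = "(\<lambda>V. sphere 0 1 \<inter> V) ` G"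
    have "?H \<subseteq> great_spheres k" using G(1) by (auto simp: great_spheres_def)
    moreover have "card ?H \<le> C" using card_image_le[OF G(2)] G(3) le_trans by blast
    moreover have "\<exists>S\<in>?H. hits S K" if K: "K \<in> F i" for K
    proof -
      obtain V where V: "V \<in> G" "meets_ball V (\<phi> K)" using G(4)[OF K] by blast
      have "K \<in> closed_caps" "subspace V" "dim V = k + 1" using F i K G(1) V(1) by blast+
      then have "hits (sphere 0 1 \<inter> V) K" using \<phi>(2)[of K V] V(2) by simp
      then show ?thesis using V(1) by blast
    qed
    ultimately show "\<exists>i\<in>{1..p}. \<exists>G\<subseteq>great_spheres k. finite G \<and> card G \<le> C \<and>
       (\<forall>B\<in>F i. \<exists>S\<in>G. hits S B)"
      using i G(2) by (intro bexI[of _ i] exI[of _ ?H]) auto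
  qed
qed

end
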